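(* Let $q\in(0,1]$ with $p<\frac qm+1$. There exist $r\ge1$ and $\delta>0$ (depending only on $p,q,m,s,d,\Omega$) such that the following holds: if $v_0\in L^\infty(\Omega)\cap W^{s,p}_0(\Omega)$ satisfies $\|v_0\|_{L^{r+\frac1m}(\Omega)}<\delta$ and $v$ is an $\infty$-weak-mild solution of $(P_q)$, then there exists $t_0>0$ such that $v(t)=0$ for all $t\ge t_0$.
   Context: Let $d\ge1$, $\Omega\subset\mathbb R^d$ a bounded smooth domain, $p\in(1,\infty)$, $s\in(0,1)$, $m>1$. $[X]^r:=|X|^{r-1}X$, $\beta(\theta)=[\theta]^{1/m}$. $W^{s,p}_0(\Omega)=\{u\in W^{s,p}(\mathbb R^d):u=0\text{ a.e. on }\mathbb R^d\setminus\Omega\}$; $\langle(-\Delta)^s_pu,\varphi\rangle=\iint_{\mathbb R^{2d}}[u(x)-u(y)]^{p-1}(\varphi(x)-\varphi(y))|x-y|^{-d-sp}dxdy$. $Q_T=(0,T)\times\Omega$, $X_T=\{v\in L^\infty(Q_T)\cap L^\infty(0,T;W^{s,p}_0):\partial_tv\in L^2(Q_T)\}$, $\mathcal W_T=\{u\in L^{m+1}(Q_T):\partial_tu\in L^{(m+1)'}(Q_T)\}$. Problem $(P_q)$: $\partial_t\beta(v)+(-\Delta)^s_pv=[v]^{q/m}$ in $Q_T$, $v=0$ outside $\Omega$, $v(0)=v_0$; write $h(t,x,\theta)=[\theta]^{q/m}$. Weak solution on $Q_T$: $v\in X_T$, $\beta(v)\in C([0,T];L^2)\cap L^{m+1}(Q_T)$,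 $v(0)=v_0$, and for all $t\in[0,T]$, $\varphi\in\mathcal W_T\cap L^p(0,T;W^{s,p}_0)$: $[\int\beta(v)\varphi]_0^t-\int_0^t\int\beta(v)\partial_t\varphi+\int_0^t\langle(-\Delta)^s_pv,\varphi\rangle=\int_0^t\int h(\tau,x,v)\varphi$. With $Au=(-\Delta)^s_p[u]^m$, $D(A)=\{u:[u]^m\in W^{s,p}_0,(-\Delta)^s_p[u]^m\in L^1\}$, a mild solution of $\partial_tu+Au=f$, $u(0)=u_0$ is $u\in C([0,T];L^1)$ such that for every $\varepsilon>0$ there is a piecewise constant $U$ on a partition $0=t_0<\dots<t_N=T$ with steps $<\varepsilon$, $U(0)=U_0$, $U=U_i$ on $(t_{i-1},t_i]$, $\|U_0-u_0\|_{L^1}\le\varepsilon$, $\frac{U_i-U_{i-1}}{t_i-t_{i-1}}+AU_i=f_i$, $\sum_i\int_{t_{i-1}}^{t_i}\|f-f_i\|_{L^1}<\varepsilon$, $\|U(t)-u(t)\|_{L^1}<\varepsilon$ for all $t$. Weak-mild solution on $Q_T$: weak solution $v$ with $\beta(v)$ mild for $f=h(\cdot,\cdot,v)$, $u_0=\beta(v_0)$. $\infty$-weak-mild solution: $v\in L^\infty_{loc}(0,\infty;L^\infty)$ weak-mild on $Q_T$ for every $T<\infty$. *)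

theory Defs
  imports "HOL-Analysis.Analysis"
begin

text \<open>[X]^r := |X|^(r-1) X, with the convention [0]^r = 0.\<close>
definition spow :: "real \<Rightarrow> real \<Rightarrow> real" where
  "spow r x = sgn x * \<bar>x\<bar> powr r"

definition beta :: "real \<Rightarrow> real \<Rightarrow> real" where
  "beta m \<theta> = spow (1 / m) \<theta>"

fun Ck :: "nat \<Rightarrow> ('b::euclidean_space \<Rightarrow> real) set" where
  "Ck 0 = {f. continuous_on UNIV f}"
| "Ck (Suc k) = {f. (\<forall>x. f differentiable (at x)) \<and>
       (\<forall>b\<in>Basis. (\<lambda>x. frechet_derivative f (at x) b) \<in> Ck k)}"

definition Cinf :: "('b::euclidean_space \<Rightarrow> real) set" where
  "Cinf = (\<Inter>k. Ck k)"

text \<open>Bounded domain with C-infinity boundary, via a smooth defining function.\<close>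
definition smooth_bounded_domain :: "'a::euclidean_space set \<Rightarrow> bool" where
  "smooth_bounded_domain \<Omega> \<longleftrightarrow> open \<Omega> \<and> bounded \<Omega> \<and> connected \<Omega> \<and> \<Omega> \<noteq> {} \<and>
     (\<exists>\<phi>\<in>Cinf. \<Omega> = {x. \<phi> x < 0} \<and>
        (\<forall>x. \<phi> x = 0 \<longrightarrow> frechet_derivative \<phi> (at x) \<noteq> (\<lambda>_. 0)))"

definition Lp_on :: "'b::euclidean_space set \<Rightarrow> real \<Rightarrow> ('b \<Rightarrow> real) \<Rightarrow> bool" where
  "Lp_on S p f \<longleftrightarrow> f \<in> borel_measurable (lebesgue_on S) \<and>
     (\<integral>\<^sup>+x. ennreal (\<bar>f x\<bar> powr p) \<partial>lebesgue_on S) < \<infinity>"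

definition Linf_on :: "'b::euclidean_space set \<Rightarrow> ('b \<Rightarrow> real) \<Rightarrow> bool" where
  "Linf_on S f \<longleftrightarrow> f \<in> borel_measurable (lebesgue_on S) \<and>
     (\<exists>C. AE x in lebesgue_on S. \<bar>f x\<bar> \<le> C)"

definition L1dist :: "'a::euclidean_space set \<Rightarrow> ('a \<Rightarrow> real) \<Rightarrow> ('a \<Rightarrow> real) \<Rightarrow> ennreal" where
  "L1dist \<Omega> f g = (\<integral>\<^sup>+x. ennreal \<bar>f x - g x\<bar> \<partial>lebesgue_on \<Omega>)"

definition cont_Lr :: "'a::euclidean_space set \<Rightarrow> real \<Rightarrow> real \<Rightarrow> (real \<Rightarrow> 'a \<Rightarrow> real) \<Rightarrow> bool" where
  "cont_Lr \<Omega> r T f \<longleftrightarrow>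
     (\<forall>t\<in>{0..T}. Lp_on \<Omega> r (f t) \<and>
        ((\<lambda>\<tau>. \<integral>\<^sup>+x. ennreal (\<bar>f \<tau> x - f t x\<bar> powr r) \<partial>lebesgue_on \<Omega>) \<longlongrightarrow> 0)
          (at t within {0..T}))"

definition gagliardo :: "real \<Rightarrow> real \<Rightarrow> ('a::euclidean_space \<Rightarrow> real) \<Rightarrow> ennreal" where
  "gagliardo s p u = (\<integral>\<^sup>+z. ennreal (\<bar>u (fst z) - u (snd z)\<bar> powr p /
        norm (fst z - snd z) powr (real DIM('a) + s * p)) \<partial>(lebesgue :: ('a \<times> 'a) measure))"

definition Wsp :: "real \<Rightarrow> real \<Rightarrow> ('a::euclidean_space \<Rightarrow> real) \<Rightarrow> bool" where
  "Wsp s p u \<longleftrightarrow> Lp_on UNIV p u \<and> gagliardo s p u < \<infinity>"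

definition W0 :: "'a::euclidean_space set \<Rightarrow> real \<Rightarrow> real \<Rightarrow> ('a \<Rightarrow> real) \<Rightarrow> bool" where
  "W0 \<Omega> s p u \<longleftrightarrow> Wsp s p u \<and> (AE x in lebesgue. x \<notin> \<Omega> \<longrightarrow> u x = 0)"

definition frac_pair :: "real \<Rightarrow> real \<Rightarrow> ('a::euclidean_space \<Rightarrow> real) \<Rightarrow> ('a \<Rightarrow> real) \<Rightarrow> real" where
  "frac_pair s p u \<phi> = (\<integral>z. spow (p - 1) (u (fst z) - u (snd z)) * (\<phi> (fst z) - \<phi> (snd z)) /
        norm (fst z - snd z) powr (real DIM('a) + s * p) \<partial>(lebesgue :: ('a \<times> 'a) measure))"

definition QT :: "real \<Rightarrow> 'a::euclidean_space set \<Rightarrow> (real \<times> 'a) set" where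
  "QT T \<Omega> = {0<..<T} \<times> \<Omega>"

definition unc :: "(real \<Rightarrow> 'a \<Rightarrow> real) \<Rightarrow> real \<times> 'a \<Rightarrow> real" where
  "unc v z = v (fst z) (snd z)"

definition test_fun :: "'b::euclidean_space set \<Rightarrow> ('b \<Rightarrow> real) \<Rightarrow> bool" where
  "test_fun U \<psi> \<longleftrightarrow> \<psi> \<in> Cinf \<and> (\<exists>K. compact K \<and> K \<subseteq> U \<and> (\<forall>z. z \<notin> K \<longrightarrow> \<psi> z = 0))"

definition dt :: "(real \<times> 'a::euclidean_space \<Rightarrow> real) \<Rightarrow> real \<times> 'a \<Rightarrow> real" where
  "dt \<psi> z = frechet_derivative \<psi> (at z) (1, 0)"

definition weak_dt :: "(real \<times> 'a::euclidean_space) set \<Rightarrow> (real \<times> 'a \<Rightarrow> real) \<Rightarrow> (real \<times> 'a \<Rightarrow> real) \<Rightarrow> bool" where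
  "weak_dt U V G \<longleftrightarrow> (\<forall>\<psi>. test_fun U \<psi> \<longrightarrow>
      (\<integral>z. V z * dt \<psi> z \<partial>lebesgue_on U) = - (\<integral>z. G z * \<psi> z \<partial>lebesgue_on U))"

definition in_XT :: "'a::euclidean_space set \<Rightarrow> real \<Rightarrow> real \<Rightarrow> real \<Rightarrow> (real \<Rightarrow> 'a \<Rightarrow> real) \<Rightarrow> bool" where
  "in_XT \<Omega> s p T v \<longleftrightarrow>
     Linf_on (QT T \<Omega>) (unc v) \<and>
     (\<exists>C::real. AE t in lebesgue_on {0<..<T}. W0 \<Omega> s p (v t) \<and>
         (\<integral>\<^sup>+x. ennreal (\<bar>v t x\<bar> powr p) \<partial>lebesgue) \<le> ennreal C \<and> gagliardo s p (v t) \<le> ennreal C) \<and>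
     (\<exists>g. Lp_on (QT T \<Omega>) 2 g \<and> weak_dt (QT T \<Omega>) (unc v) g)"

text \<open>phi in W_T \<inter> L^p(0,T;W^{s,p}_0) with weak time derivative g, taken as its
  continuous representative in C([0,T]; L^{(m+1)'}(Omega))\<close>
definition WT_test :: "'a::euclidean_space set \<Rightarrow> real \<Rightarrow> real \<Rightarrow> real \<Rightarrow> real \<Rightarrow>
     (real \<Rightarrow> 'a \<Rightarrow> real) \<Rightarrow> (real \<times> 'a \<Rightarrow> real) \<Rightarrow> bool" where
  "WT_test \<Omega> s p m T \<phi> g \<longleftrightarrow>
     Lp_on (QT T \<Omega>) (m + 1) (unc \<phi>) \<and> Lp_on (QT T \<Omega>) ((m + 1) / m) g \<and>
     weak_dt (QT T \<Omega>) (unc \<phi>) g \<and>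
     (AE t in lebesgue_on {0<..<T}. W0 \<Omega> s p (\<phi> t)) \<and>
     (\<integral>\<^sup>+t. (\<integral>\<^sup>+x. ennreal (\<bar>\<phi> t x\<bar> powr p) \<partial>lebesgue) + gagliardo s p (\<phi> t)
        \<partial>lebesgue_on {0<..<T}) < \<infinity> \<and>
     cont_Lr \<Omega> ((m + 1) / m) T \<phi>"

definition weak_sol :: "'a::euclidean_space set \<Rightarrow> real \<Rightarrow> real \<Rightarrow> real \<Rightarrow> real \<Rightarrow> real \<Rightarrow>
     ('a \<Rightarrow> real) \<Rightarrow> (real \<Rightarrow> 'a \<Rightarrow> real) \<Rightarrow> bool" where
  "weak_sol \<Omega> s p m q T v0 v \<longleftrightarrow>
     in_XT \<Omega> s p T v \<and>
     cont_Lr \<Omega> 2 T (\<lambda>t x. beta m (v t x)) \<and>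
     Lp_on (QT T \<Omega>) (m + 1) (\<lambda>z. beta m (unc v z)) \<and>
     (AE x in lebesgue_on \<Omega>. v 0 x = v0 x) \<and>
     (\<forall>t\<in>{0..T}. \<forall>\<phi> g. WT_test \<Omega> s p m T \<phi> g \<longrightarrow>
        (\<integral>x. beta m (v t x) * \<phi> t x \<partial>lebesgue_on \<Omega>) - (\<integral>x. beta m (v 0 x) * \<phi> 0 x \<partial>lebesgue_on \<Omega>)
        - (\<integral>z. beta m (unc v z) * g z \<partial>lebesgue_on (QT t \<Omega>))
        + (\<integral>\<tau>. frac_pair s p (v \<tau>) (\<phi> \<tau>) \<partial>lebesgue_on {0<..<t})
        = (\<integral>z. spow (q / m) (unc v z) * unc \<phi> z \<partial>lebesgue_on (QT t \<Omega>)))"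

text \<open>A u = f in L^1(Omega), A u = (-Delta)^s_p [u]^m, with u in D(A)\<close>
definition A_rel :: "'a::euclidean_space set \<Rightarrow> real \<Rightarrow> real \<Rightarrow> real \<Rightarrow> ('a \<Rightarrow> real) \<Rightarrow> ('a \<Rightarrow> real) \<Rightarrow> bool" where
  "A_rel \<Omega> s p m u f \<longleftrightarrow>
     Lp_on \<Omega> 1 u \<and> Lp_on \<Omega> 1 f \<and>
     W0 \<Omega> s p (\<lambda>x. if x \<in> \<Omega> then spow m (u x) else 0) \<and>
     (\<forall>\<phi>. W0 \<Omega> s p \<phi> \<and> Linf_on UNIV \<phi> \<longrightarrow>
        frac_pair s p (\<lambda>x. if x \<in> \<Omega> then spow m (u x) else 0) \<phi> = (\<integral>x. f x * \<phi> x \<partial>lebesgue_on \<Omega>))"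

definition mild_sol :: "'a::euclidean_space set \<Rightarrow> real \<Rightarrow> real \<Rightarrow> real \<Rightarrow> real \<Rightarrow>
     (real \<Rightarrow> 'a \<Rightarrow> real) \<Rightarrow> ('a \<Rightarrow> real) \<Rightarrow> (real \<Rightarrow> 'a \<Rightarrow> real) \<Rightarrow> bool" where
  "mild_sol \<Omega> s p m T f u0 u \<longleftrightarrow>
     cont_Lr \<Omega> 1 T u \<and>
     (\<forall>\<epsilon>>0. \<exists>(N::nat) (tt::nat \<Rightarrow> real) (U::nat \<Rightarrow> 'a \<Rightarrow> real) (fi::nat \<Rightarrow> 'a \<Rightarrow> real).
        tt 0 = 0 \<and> tt N = T \<and>
        (\<forall>i\<in>{1..N}. tt (i - 1) < tt i \<and> tt i - tt (i - 1) < \<epsilon>) \<and>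
        Lp_on \<Omega> 1 (U 0) \<and> L1dist \<Omega> (U 0) u0 \<le> ennreal \<epsilon> \<and>
        (\<forall>i\<in>{1..N}. A_rel \<Omega> s p m (U i)
            (\<lambda>x. fi i x - (U i x - U (i - 1) x) / (tt i - tt (i - 1)))) \<and>
        (\<Sum>i=1..N. \<integral>\<^sup>+z. ennreal \<bar>f (fst z) (snd z) - fi i (snd z)\<bar>
             \<partial>lebesgue_on ({tt (i - 1)<..<tt i} \<times> \<Omega>)) < ennreal \<epsilon> \<and>
        L1dist \<Omega> (U 0) (u 0) < ennreal \<epsilon> \<and>
        (\<forall>i\<in>{1..N}. \<forall>\<tau>\<in>{tt (i - 1)<..tt i}. L1dist \<Omega> (U i) (u \<tau>) < ennreal \<epsilon>))"

definition weak_mild_sol :: "'a::euclidean_space set \<Rightarrow> real \<Rightarrow> real \<Rightarrow> real \<Rightarrow> real \<Rightarrow> real \<Rightarrow>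
     ('a \<Rightarrow> real) \<Rightarrow> (real \<Rightarrow> 'a \<Rightarrow> real) \<Rightarrow> bool" where
  "weak_mild_sol \<Omega> s p m q T v0 v \<longleftrightarrow>
     weak_sol \<Omega> s p m q T v0 v \<and>
     mild_sol \<Omega> s p m T (\<lambda>t x. spow (q / m) (v t x)) (\<lambda>x. beta m (v0 x)) (\<lambda>t x. beta m (v t x))"

definition inf_weak_mild_sol :: "'a::euclidean_space set \<Rightarrow> real \<Rightarrow> real \<Rightarrow> real \<Rightarrow> real \<Rightarrow>
     ('a \<Rightarrow> real) \<Rightarrow> (real \<Rightarrow> 'a \<Rightarrow> real) \<Rightarrow> bool" where
  "inf_weak_mild_sol \<Omega> s p m q v0 v \<longleftrightarrow>
     (\<forall>T>0. Linf_on (QT T \<Omega>) (unc v) \<and> weak_mild_sol \<Omega> s p m q T v0 v)"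

end

theory Submission
  imports Defs
begin

text \<open>
  Only the mild formulation is used. Test the implicit Euler equation for \<open>U\<^sub>i\<close> with the truncated
  power \<open>[w]\<^sup>r\<close>, \<open>w = [U\<^sub>i]\<^sup>m\<close>, where \<open>r\<close> is so large that a slightly improved fractional Poincare
  inequality bounds \<open>Y = \<integral> |v| powr (r + 1/m)\<close> by the energy. Convexity of the primitive of the test
  function replaces the chain rule in time. As the mesh goes to zero, \<open>Y\<close> decays at a rate
  \<open>c * Y powr a - C * Y powr b\<close> with \<open>a < 1\<close>, and \<open>p < q/m + 1\<close> says exactly that \<open>a < b\<close>. Hence for small
  data the source is absorbed, and \<open>a < 1\<close> forces extinction at a time that depends only on the
  bound for \<open>Y(0)\<close>; the truncation level, which depends on the time horizon, does not enter.
\<close>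

section \<open>Signed powers and truncation\<close>

text \<open>A mild solution offers only \<open>L^1\<close> closeness of the Euler iterates to
  \<open>beta m (v t)\<close>, without a pointwise bound on the iterates, and high powers are not
  continuous in \<open>L^1\<close>. Clipping at a level \<open>L\<close> makes every functional
  involved Lipschitz in \<open>L^1\<close>; on \<open>beta m (v t)\<close> itself it acts trivially
  at almost every time. The energy gives \<open>Y powr a\<close> with
  \<open>a = (r + p - 1) / (r + 1/m)\<close>. By Jensen's inequality on the bounded domain the
  source gives \<open>Y powr b\<close> with \<open>b = (r + q/m) / (r + 1/m)\<close>, so the two
  exponents compare through their numerators. As \<open>q <= 1\<close>, also
  \<open>p - 1 < 1/m\<close>, hence \<open>a < 1\<close>. For the same reason the energy must
  control an integral of a function to the power \<open>p / a > p\<close>, which the plain Poincare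
  inequality does not do; since \<open>a\<close> tends to \<open>1\<close> for large
  \<open>r\<close>, any gain of integrability suffices. The source error is small only as a
  space-time integral, so it is evaluated at one well-chosen time per slab of the mesh.\<close>

lemma powr_tangent_le:
  fixes x y l :: real
  assumes "0 \<le> x" "0 \<le> y" "1 \<le> l"
  shows "y powr l + l * y powr (l - 1) * (x - y) \<le> x powr l"
proof (cases "x = 0 \<or> y = 0 \<or> l = 1")
  case True
  then consider "y = 0" | "x = 0" | "l = 1" "x \<noteq> 0" "y \<noteq> 0" by blast
  then show ?thesis
  proof cases
    case 2
    have "y powr l = y powr (l - 1) * y"
      using assms powr_mult_base[of y "l - 1"] by (simp add: mult.commute)
    moreover have "1 * (y powr (l - 1) * y) \<le> l * (y powr (l - 1) * y)"
      using assms by (intro mult_right_mono) auto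
    ultimately show ?thesis using 2 by simp
  qed (use assms in auto)
next
  case False
  with assms have pos: "0 < x" "0 < y" "1 < l" by auto
  \<comment> \<open>Weighted AM-GM with weights \<open>1/l\<close> and \<open>1 - 1/l\<close>; the
    left-hand side is \<open>x * y powr (l - 1)\<close>.\<close>
  have "(x powr l) powr (1/l) * (y powr l) powr (1 - 1/l) \<le> (1/l) * (x powr l) + (1 - 1/l) * y powr l"
    by (rule Youngs_inequality_0) (use pos in auto)
  then have "x * y powr (l - 1) \<le> (1/l) * (x powr l) + (1 - 1/l) * y powr l"
    using pos by (simp add: powr_powr right_diff_distrib)
  then have "l * (x * y powr (l - 1)) \<le> l * ((1/l) * (x powr l) + (1 - 1/l) * y powr l)"
    using pos by (intro mult_left_mono) auto
  also have "\<dots> = x powr l + (l - 1) * y powr l"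
    using pos by (simp add: field_simps)
  finally have "l * (x * y powr (l - 1)) \<le> x powr l + (l - 1) * y powr l" .
  moreover have "y powr l = y powr (l - 1) * y"
    using pos powr_mult_base[of y "l - 1"] by (simp add: mult.commute)
  ultimately show ?thesis by (simp add: algebra_simps)
qed

text \<open>Weighted AM-GM again. The point of contact \<open>y\<close> stays free: choosing an
  integral for it later yields Jensen's inequality, choosing a power of a seminorm bound yields
  interpolation between exponents.\<close>

lemma powr_concave_tangent:
  fixes a t y :: real
  assumes "0 < a" "a \<le> 1" "0 \<le> t" "0 < y"
  shows "t powr a \<le> y powr a * (1 - a + a * (t / y))"
proof (cases "a = 1 \<or> t = 0")
  case True
  with assms show ?thesis by (auto simp: field_simps)
next
  case False
  with assms have pos: "0 < a" "a < 1" "0 < t" by auto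
  have "(t / y) powr a * 1 powr (1 - a) \<le> a * (t / y) + (1 - a) * 1"
    by (rule Youngs_inequality_0) (use pos assms in auto)
  then have "y powr a * (t / y) powr a \<le> y powr a * (1 - a + a * (t / y))"
    by (intro mult_left_mono) auto
  moreover have "y powr a * (t / y) powr a = t powr a"
    using assms by (simp flip: powr_mult)
  ultimately show ?thesis by simp
qed

lemma powr_add_le:
  fixes a x y :: real
  assumes "0 < a" "a \<le> 1" "0 \<le> x" "0 \<le> y"
  shows "(x + y) powr a \<le> x powr a + y powr a"
proof (cases "x + y = 0")
  case False
  with assms have pos: "0 < x + y" by auto
  have *: "z / (x + y) \<le> (z / (x + y)) powr a" if "0 \<le> z" "z \<le> x + y" for z
    using powr_mono'[of a 1 "z / (x + y)"] that pos assms by auto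
  have "1 = x / (x + y) + y / (x + y)"
    using pos by (simp add: add_divide_distrib[symmetric])
  also have "\<dots> \<le> (x / (x + y)) powr a + (y / (x + y)) powr a"
    using *[of x] *[of y] assms by auto
  also have "\<dots> = (x powr a + y powr a) / (x + y) powr a"
    by (simp add: powr_divide add_divide_distrib)
  finally show ?thesis using pos by (simp add: field_simps)
qed simp

lemma powr_diff_le:
  fixes a x y :: real
  assumes "0 < a" "a \<le> 1" "0 \<le> x" "0 \<le> y"
  shows "x powr a \<le> y powr a + \<bar>x - y\<bar> powr a"
proof -
  have "x powr a \<le> (y + \<bar>x - y\<bar>) powr a"
    using assms by (intro powr_mono2) auto
  also have "\<dots> \<le> y powr a + \<bar>x - y\<bar> powr a"
    using assms by (intro powr_add_le) auto
  finally show ?thesis .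
qed

lemma add_powr_le:
  fixes p x y :: real
  assumes "0 < p" "0 \<le> x" "0 \<le> y"
  shows "(x + y) powr p \<le> 2 powr p * (x powr p + y powr p)"
proof -
  have "(x + y) powr p \<le> (2 * max x y) powr p"
    using assms by (intro powr_mono2) auto
  also have "\<dots> = 2 powr p * max x y powr p"
    by (simp add: powr_mult)
  also have "\<dots> \<le> 2 powr p * (x powr p + y powr p)"
    by (intro mult_left_mono) (auto simp: max_def)
  finally show ?thesis .
qed

lemma spow_0 [simp]: "spow r 0 = 0"
  by (simp add: spow_def)

lemma spow_nonneg: "0 \<le> x \<Longrightarrow> spow r x = x powr r"
  by (auto simp: spow_def sgn_real_def)

lemma spow_minus [simp]: "spow r (- x) = - spow r x"
  by (simp add: spow_def)

lemma abs_spow [simp]: "\<bar>spow r x\<bar> = \<bar>x\<bar> powr r"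
  by (auto simp: spow_def sgn_real_def)

lemma sgn_spow [simp]: "sgn (spow r x) = sgn x"
  by (auto simp: spow_def sgn_real_def)

lemma spow_spow: "spow a (spow b x) = spow (b * a) x"
  unfolding spow_def[of a] sgn_spow abs_spow by (simp add: spow_def powr_powr)

lemma spow_mono:
  assumes "0 < r" "x \<le> y"
  shows "spow r x \<le> spow r y"
  using assms powr_mono2[of r x y] powr_mono2[of r "- y" "- x"]
    order_trans[of "- (\<bar>x\<bar> powr r)" 0 "\<bar>y\<bar> powr r"]
  by (auto simp: spow_def sgn_real_def)

lemma borel_measurable_spow [measurable]: "spow r \<in> borel_measurable borel"
  unfolding spow_def by measurable

lemma spow_lipschitz_ordered:
  assumes "1 \<le> g" "b \<le> a" "\<bar>a\<bar> \<le> K" "\<bar>b\<bar> \<le> K"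
  shows "spow g a - spow g b \<le> g * K powr (g - 1) * (a - b)"
proof -
  have nn: "a powr g - b powr g \<le> g * K powr (g - 1) * (a - b)"
    if "0 \<le> b" "b \<le> a" "a \<le> K" for a b
  proof -
    have "a powr g - b powr g \<le> g * a powr (g - 1) * (a - b)"
      using powr_tangent_le[of b a g] that assms by (simp add: algebra_simps)
    also have "\<dots> \<le> g * K powr (g - 1) * (a - b)"
      using that assms by (intro mult_right_mono mult_left_mono powr_mono2) auto
    finally show ?thesis .
  qed
  consider "0 \<le> b" | "a \<le> 0" | "b < 0" "0 < a" by linarith
  then show ?thesis
  proof cases
    case 1 then show ?thesis using nn[of b a] assms by (simp add: spow_nonneg)
  next
    case 2
    then show ?thesis using nn[of "-a" "-b"] assms spow_nonneg[of "-a" g] spow_nonneg[of "-b" g] by simp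
  next
    case 3
    have "spow g a - spow g b = a powr g + (-b) powr g"
      using 3 spow_nonneg[of a g] spow_nonneg[of "-b" g] by simp
    also have "\<dots> \<le> g * K powr (g - 1) * a + g * K powr (g - 1) * (- b)"
      using nn[of 0 a] nn[of 0 "-b"] 3 assms by (intro add_mono) auto
    finally show ?thesis by (simp add: algebra_simps)
  qed
qed

lemma spow_lipschitz:
  assumes "1 \<le> g" "\<bar>a\<bar> \<le> K" "\<bar>b\<bar> \<le> K"
  shows "\<bar>spow g a - spow g b\<bar> \<le> g * K powr (g - 1) * \<bar>a - b\<bar>"
  using spow_lipschitz_ordered[of g a b K] spow_lipschitz_ordered[of g b a K] 
    spow_mono[of g a b] spow_mono[of g b a] assms
  by (cases "b \<le> a") (simp_all add: abs_if)

lemma abs_powr_lipschitz: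
  fixes a b :: real
  assumes "1 \<le> g" "\<bar>a\<bar> \<le> K" "\<bar>b\<bar> \<le> K"
  shows "\<bar>\<bar>a\<bar> powr g - \<bar>b\<bar> powr g\<bar> \<le> g * K powr (g - 1) * \<bar>a - b\<bar>"
proof -
  have "\<bar>\<bar>a\<bar> powr g - \<bar>b\<bar> powr g\<bar> = \<bar>spow g \<bar>a\<bar> - spow g \<bar>b\<bar>\<bar>"
    by (simp add: spow_nonneg)
  also have "\<dots> \<le> g * K powr (g - 1) * \<bar>\<bar>a\<bar> - \<bar>b\<bar>\<bar>"
    using assms by (intro spow_lipschitz) auto
  also have "\<dots> \<le> g * K powr (g - 1) * \<bar>a - b\<bar>"
    using assms by (intro mult_left_mono) auto
  finally show ?thesis .
qed

text \<open>The reflection that sends \<open>a\<close>, \<open>b\<close> to \<open>-b\<close>,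
  \<open>-a\<close> reduces everything to \<open>|b| <= a\<close>. For \<open>b >= 0\<close> the
  bound holds with factor \<open>1\<close>; the factor \<open>2\<close> pays for opposite signs,
  where \<open>a - b <= 2 * a\<close> and \<open>spow r a\<close> alone is large enough.\<close>

lemma spow_coercive_ordered:
  assumes "1 \<le> r" "b \<le> a" 
  shows "max \<bar>a\<bar> \<bar>b\<bar> powr (r - 1) * (a - b) \<le> 2 * (spow r a - spow r b)"
proof -
  have nn: "a powr (r - 1) * (a - b) \<le> 2 * (spow r a - spow r b)"
    if "0 \<le> a" "\<bar>b\<bar> \<le> a" for a b
  proof -
    have a: "a powr r = a powr (r - 1) * a"
      using that powr_mult_base[of a "r - 1"] by (simp add: mult.commute)
    show ?thesis
    proof (cases "0 \<le> b")
      case True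
      have "b powr r = b powr (r - 1) * b"
        using True powr_mult_base[of b "r - 1"] by (simp add: mult.commute)
      also have "\<dots> \<le> a powr (r - 1) * b"
        using True that assms by (intro mult_right_mono powr_mono2) auto
      finally have "a powr (r - 1) * (a - b) \<le> spow r a - spow r b"
        using True that a by (simp add: spow_nonneg algebra_simps)
      moreover have "0 \<le> spow r a - spow r b"
        using that assms by (simp add: spow_mono)
      ultimately show ?thesis by simp
    next
      case False
      have "a powr (r - 1) * (a - b) \<le> a powr (r - 1) * (2 * a)"
        using that by (intro mult_left_mono) auto
      also have "\<dots> = 2 * spow r a"
        using that a by (simp add: spow_nonneg)
      also have "\<dots> \<le> 2 * (spow r a - spow r b)"
        using False assms spow_mono[of r b 0] by simp
      finally show ?thesis .
    qed
  qed
  show ?thesis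
  proof (cases "\<bar>b\<bar> \<le> a")
    case True then show ?thesis using nn[of a b] by (simp add: max_def)
  next
    case False
    with assms have "\<bar>a\<bar> \<le> - b" "0 \<le> - b" by auto
    then show ?thesis using nn[of "-b" "-a"] assms by (auto simp add: max_def algebra_simps)
  qed
qed

text \<open>A Stroock-Varopoulos type inequality, the algebra behind the test function
  \<open>[w]^r\<close>. The exponent \<open>g\<close> satisfies \<open>(g - 1) * p = r - 1\<close>,
  so the \<open>p\<close>-th power of the Lipschitz bound for \<open>spow g\<close> is, up to
  \<open>g powr p\<close>, the product \<open>K powr (r - 1) * (a - b) powr p\<close>; coercivity of
  \<open>spow r\<close> absorbs \<open>K powr (r - 1)\<close> together with one factor
  \<open>a - b\<close>.\<close>

lemma spow_monotonicity_ordered: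
  assumes p: "1 < p" and r: "1 \<le> r" and g: "g = (r + p - 1) / p" and "b \<le> a"
  shows "\<bar>spow g a - spow g b\<bar> powr p \<le> 2 * g powr p * (spow (p - 1) (a - b) * (spow r a - spow r b))"
proof -
  define K where "K = max \<bar>a\<bar> \<bar>b\<bar>"
  have g1: "1 \<le> g" using p r g by simp
  have gp: "(g - 1) * p = r - 1" using p g by (simp add: field_simps)
  have "\<bar>spow g a - spow g b\<bar> powr p \<le> (g * K powr (g - 1) * (a - b)) powr p"
    using spow_lipschitz[of g a K b] g1 assms by (intro powr_mono2) (auto simp: K_def)
  also have "\<dots> = g powr p * (K powr (r - 1) * ((a - b) powr (p - 1) * (a - b)))"
    using powr_mult_base[of "a - b" "p - 1"] \<open>b \<le> a\<close> gp
    by (simp add: powr_mult powr_powr mult.commute)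
  also have "\<dots> = g powr p * ((a - b) powr (p - 1) * (K powr (r - 1) * (a - b)))"
    by simp
  also have "\<dots> \<le> g powr p * ((a - b) powr (p - 1) * (2 * (spow r a - spow r b)))"
    using spow_coercive_ordered[OF r \<open>b \<le> a\<close>] by (intro mult_left_mono) (auto simp: K_def)
  finally show ?thesis using \<open>b \<le> a\<close> by (simp add: spow_nonneg algebra_simps)
qed

lemma spow_monotonicity:
  assumes "1 < p" "1 \<le> r" "g = (r + p - 1) / p"
  shows "\<bar>spow g a - spow g b\<bar> powr p \<le> 2 * g powr p * (spow (p - 1) (a - b) * (spow r a - spow r b))"
proof (cases "b \<le> a")
  case True then show ?thesis using spow_monotonicity_ordered assms by blast
next
  case False
  then have "\<bar>spow g b - spow g a\<bar> powr p \<le> 2 * g powr p * (spow (p - 1) (b - a) * (spow r b - spow r a))"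
    using assms by (intro spow_monotonicity_ordered) auto
  moreover have "spow (p - 1) (b - a) = - spow (p - 1) (a - b)"
    using spow_minus[of "p - 1" "a - b"] by simp
  ultimately show ?thesis by (simp add: abs_minus_commute algebra_simps)
qed

section \<open>Truncation, and the convex primitive of the truncated test function\<close>

definition clip :: "real \<Rightarrow> real \<Rightarrow> real" where
  "clip M x = max (- M) (min M x)"

lemma borel_measurable_clip [measurable]: "clip M \<in> borel_measurable borel"
  unfolding clip_def by measurable

lemma clip_0 [simp]: "0 \<le> M \<Longrightarrow> clip M 0 = 0"
  by (simp add: clip_def)

lemma abs_clip_le: "0 \<le> M \<Longrightarrow> \<bar>clip M x\<bar> \<le> M"
  by (auto simp: clip_def)

lemma abs_clip: "0 \<le> M \<Longrightarrow> \<bar>clip M x\<bar> = min \<bar>x\<bar> M"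
  by (auto simp: clip_def)

lemma sgn_clip: "0 < M \<Longrightarrow> sgn (clip M x) = sgn x"
  by (auto simp: clip_def sgn_real_def)

lemma clip_mono: "x \<le> y \<Longrightarrow> clip M x \<le> clip M y"
  by (auto simp: clip_def)

lemma clip_lipschitz: "\<bar>clip M x - clip M y\<bar> \<le> \<bar>x - y\<bar>"
  by (auto simp: clip_def)

lemma clip_eq: "\<bar>x\<bar> \<le> M \<Longrightarrow> clip M x = x"
  by (auto simp: clip_def)

text \<open>Signed powers are increasing, so truncation commutes with them at matching levels. The
  operator is tested with a truncation of \<open>[U]^m\<close>, the time difference involves
  \<open>U\<close> itself; this identifies the two truncations.\<close>

lemma clip_spow:
  assumes "0 < M" "0 < m"
  shows "clip (M powr m) (spow m x) = spow m (clip M x)"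
  using spow_mono[of m x M] spow_mono[of m "-M" x] spow_mono[of m M x] spow_mono[of m x "- M"] 
    spow_nonneg[of M m] assms unfolding clip_def
  by (auto simp: max_def min_def)

text \<open>\<open>clip M\<close> is monotone and 1-Lipschitz: both factors have the sign of
  \<open>a - b\<close>, and undoing the truncation in the first can only enlarge it in absolute
  value. Thus the operator keeps the full difference while the test function is truncated.\<close>

lemma spow_diff_clip_le:
  assumes "1 < p" "1 \<le> r"
  shows "spow (p - 1) (clip M a - clip M b) * (spow r (clip M a) - spow r (clip M b))
    \<le> spow (p - 1) (a - b) * (spow r (clip M a) - spow r (clip M b))"
proof (cases "b \<le> a")
  case True
  then have "clip M a - clip M b \<le> a - b" using clip_lipschitz[of M a b] by auto
  then show ?thesis
    using True assms clip_mono[of b a M] by (intro mult_right_mono spow_mono) (auto intro: spow_mono)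
next
  case False
  then have "a - b \<le> clip M a - clip M b" using clip_lipschitz[of M a b] by auto
  then show ?thesis
    using False assms clip_mono[of a b M] by (intro mult_right_mono_neg spow_mono) (auto intro: spow_mono)
qed

lemma spow_clip_lipschitz:
  assumes "1 \<le> r" "0 \<le> M"
  shows "\<bar>spow r (clip M a) - spow r (clip M b)\<bar> \<le> r * M powr (r - 1) * \<bar>a - b\<bar>"
proof -
  have "\<bar>spow r (clip M a) - spow r (clip M b)\<bar> \<le> r * M powr (r - 1) * \<bar>clip M a - clip M b\<bar>"
    using assms by (intro spow_lipschitz abs_clip_le)
  also have "\<dots> \<le> r * M powr (r - 1) * \<bar>a - b\<bar>"
    using assms clip_lipschitz by (intro mult_left_mono) auto
  finally show ?thesis .
qed

text \<open>For \<open>l > 1\<close> and \<open>L > 0\<close> this is the even convex primitive of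
  \<open>spow (l - 1) (clip L a)\<close>: it equals \<open>|a| powr l / l\<close> up to
  \<open>L\<close> and continues along the tangent line beyond. Linear growth is what mere
  integrability of the iterates allows.\<close>

definition truncated_power :: "real \<Rightarrow> real \<Rightarrow> real \<Rightarrow> real" where
  "truncated_power l L a = \<bar>clip L a\<bar> powr l / l + \<bar>clip L a\<bar> powr (l - 1) * (\<bar>a\<bar> - \<bar>clip L a\<bar>)"

lemma borel_measurable_truncated_power [measurable]: "truncated_power l L \<in> borel_measurable borel"
  unfolding truncated_power_def by measurable

lemma truncated_power_eq: "\<bar>a\<bar> \<le> L \<Longrightarrow> truncated_power l L a = \<bar>a\<bar> powr l / l"
  by (simp add: truncated_power_def clip_eq)

text \<open>The tangent line at \<open>y <= L\<close>, as a function of \<open>|b|\<close>, stays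
  below: up to \<open>L\<close> by convexity, beyond \<open>L\<close> because its slope
  \<open>y powr (l - 1)\<close> is at most the slope \<open>L powr (l - 1)\<close> of the linear
  continuation.\<close>

lemma truncated_power_lower:
  assumes "1 < l" "0 \<le> L" "0 \<le> y" "y \<le> L"
  shows "y powr l / l + y powr (l - 1) * (\<bar>b\<bar> - y) \<le> truncated_power l L b"
proof -
  have Y: "y powr l / l + y powr (l - 1) * (x - y) \<le> x powr l / l" if "0 \<le> x" for x
  proof -
    have "(y powr l + l * y powr (l - 1) * (x - y)) / l \<le> x powr l / l"
      using powr_tangent_le[of x y l] assms that by (intro divide_right_mono) auto
    then show ?thesis using assms by (simp add: add_divide_distrib)
  qed
  show ?thesis
  proof (cases "\<bar>b\<bar> \<le> L")
    case True then show ?thesis using Y[of "\<bar>b\<bar>"] by (simp add: truncated_power_eq)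
  next
    case False
    then have c: "\<bar>clip L b\<bar> = L" using assms by (simp add: abs_clip)
    have "y powr (l - 1) * (\<bar>b\<bar> - L) \<le> L powr (l - 1) * (\<bar>b\<bar> - L)"
      using False assms by (intro mult_right_mono powr_mono2) auto
    then show ?thesis unfolding truncated_power_def c
      using Y[of L] assms by (simp add: algebra_simps)
  qed
qed

lemma truncated_power_subgradient:
  assumes "1 < l" "0 < L"
  shows "truncated_power l L a + spow (l - 1) (clip L a) * (b - a) \<le> truncated_power l L b"
proof -
  define y where "y = \<bar>clip L a\<bar>"
  have y: "0 \<le> y" "y \<le> L" using abs_clip_le[of L a] assms by (auto simp: y_def)
  have s: "spow (l - 1) (clip L a) = sgn a * y powr (l - 1)"
    using assms by (simp add: spow_def sgn_clip y_def)
  have "sgn a * (b - a) \<le> \<bar>b\<bar> - \<bar>a\<bar>"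
    by (auto simp: sgn_real_def)
  then have "y powr (l - 1) * (sgn a * (b - a)) \<le> y powr (l - 1) * (\<bar>b\<bar> - \<bar>a\<bar>)"
    by (intro mult_left_mono) auto
  then have "truncated_power l L a + spow (l - 1) (clip L a) * (b - a)
     \<le> y powr l / l + y powr (l - 1) * (\<bar>a\<bar> - y) + y powr (l - 1) * (\<bar>b\<bar> - \<bar>a\<bar>)"
    by (simp add: truncated_power_def s y_def mult_ac)
  also have "\<dots> = y powr l / l + y powr (l - 1) * (\<bar>b\<bar> - y)"
    by (simp add: algebra_simps)
  also have "\<dots> \<le> truncated_power l L b"
    using truncated_power_lower assms y by auto
  finally show ?thesis .
qed

lemma abs_spow_clip_le: "0 \<le> L \<Longrightarrow> 0 < r \<Longrightarrow> \<bar>spow r (clip L a)\<bar> \<le> L powr r"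
  using abs_clip_le[of L a] by (simp add: powr_mono2)

text \<open>The subgradients are bounded by \<open>L powr (l - 1)\<close>. This makes the integral
  of the primitive continuous in \<open>L^1\<close>, the topology in which mild solutions are
  approximated.\<close>

lemma truncated_power_lipschitz:
  assumes "1 < l" "0 < L"
  shows "\<bar>truncated_power l L a - truncated_power l L b\<bar> \<le> L powr (l - 1) * \<bar>a - b\<bar>"
proof -
  have *: "truncated_power l L a - truncated_power l L b \<le> L powr (l - 1) * \<bar>a - b\<bar>" for a b
  proof -
    have "truncated_power l L a - truncated_power l L b \<le> spow (l - 1) (clip L a) * (a - b)"
      using truncated_power_subgradient[OF assms, of a b] by (simp add: algebra_simps)
    also have "\<dots> \<le> \<bar>spow (l - 1) (clip L a)\<bar> * \<bar>a - b\<bar>"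
      by (metis abs_ge_self abs_mult)
    also have "\<dots> \<le> L powr (l - 1) * \<bar>a - b\<bar>"
      using assms by (intro mult_right_mono abs_spow_clip_le) auto
    finally show ?thesis .
  qed
  show ?thesis using *[of a b] *[of b a] by (simp add: abs_le_iff abs_minus_commute)
qed

lemma truncated_power_nonneg: "1 < l \<Longrightarrow> 0 \<le> L \<Longrightarrow> 0 \<le> truncated_power l L a"
  by (auto simp: truncated_power_def abs_clip)

lemma truncated_power_eq_0_iff:
  assumes "1 < l" "0 < L"
  shows "truncated_power l L a = 0 \<longleftrightarrow> a = 0"
proof
  assume "truncated_power l L a = 0"
  moreover have "0 \<le> \<bar>clip L a\<bar> powr l / l" "0 \<le> \<bar>clip L a\<bar> powr (l - 1) * (\<bar>a\<bar> - \<bar>clip L a\<bar>)"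
    using assms by (auto simp: abs_clip)
  ultimately have "\<bar>clip L a\<bar> powr l / l = 0"
    unfolding truncated_power_def by linarith
  with assms show "a = 0" by (auto simp: clip_def max_def min_def split: if_splits)
qed (use assms in \<open>simp add: truncated_power_def\<close>)

text \<open>A tangent line never exceeds the convex power. At time zero this bounds the functional
  by the full power of the initial value for every \<open>L\<close>, so the smallness threshold can
  be fixed before \<open>L\<close>.\<close>

lemma truncated_power_le:
  assumes "1 < l" "0 < L"
  shows "truncated_power l L a \<le> \<bar>a\<bar> powr l / l"
proof -
  have "\<bar>clip L a\<bar> powr l + l * \<bar>clip L a\<bar> powr (l - 1) * (\<bar>a\<bar> - \<bar>clip L a\<bar>) \<le> \<bar>a\<bar> powr l"
    using assms by (intro powr_tangent_le) auto
  then have "(\<bar>clip L a\<bar> powr l + l * \<bar>clip L a\<bar> powr (l - 1) * (\<bar>a\<bar> - \<bar>clip L a\<bar>)) / l \<le> \<bar>a\<bar> powr l / l"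
    using assms by (intro divide_right_mono) auto
  then show ?thesis using assms by (simp add: truncated_power_def add_divide_distrib)
qed

section \<open>A fractional Sobolev inequality\<close>

lemma borel_measurable_lebesgue_AE_cong:
  assumes g: "g \<in> borel_measurable lebesgue" and ae: "AE x in lebesgue. f x = g x"
  shows "f \<in> borel_measurable lebesgue"
proof (rule measurableI)
  fix A :: "'b set" assume A: "A \<in> sets borel"
  have "AE x in lebesgue. x \<in> g -` A \<longleftrightarrow> x \<in> f -` A"
    using ae by eventually_elim simp
  moreover have "g -` A \<in> sets lebesgue"
    using measurable_sets[OF g A] by simp
  ultimately have "f -` A \<in> sets lebesgue"
    by (rule completion.in_sets_AE) auto
  then show "f -` A \<inter> space lebesgue \<in> sets lebesgue" by simp
qed auto

lemma AE_lebesgue_fst_snd: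
  fixes P :: "'b::euclidean_space \<Rightarrow> 'c::euclidean_space \<Rightarrow> bool"
  assumes "AE z in lebesgue. P (fst z) (snd z)"
  shows "AE x in lebesgue. AE y in lebesgue. P x y"
proof -
  have "AE z in lborel \<Otimes>\<^sub>M lborel. P (fst z) (snd z)"
    using assms unfolding lborel_prod by (simp add: AE_completion_iff)
  from lborel_pair.AE_pair[OF this] show ?thesis
    by (simp add: AE_completion_iff)
qed

text \<open>Tonelli through a Borel representative: it agrees with \<open>H\<close> almost
  everywhere on the product, hence on almost every slice, and completion does not change
  integrals.\<close>

lemma nn_integral_lebesgue_prod:
  fixes H :: "'b::euclidean_space \<times> 'c::euclidean_space \<Rightarrow> ennreal"
  assumes H: "H \<in> borel_measurable lebesgue"
  shows "(\<lambda>x. \<integral>\<^sup>+y. H (x, y) \<partial>lebesgue) \<in> borel_measurable lebesgue"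
    and "(\<integral>\<^sup>+z. H z \<partial>lebesgue) = (\<integral>\<^sup>+x. \<integral>\<^sup>+y. H (x, y) \<partial>lebesgue \<partial>lebesgue)"
proof -
  obtain H' where H': "H' \<in> borel_measurable lborel" and ae: "AE z in lborel. H z = H' z"
    using completion_ex_borel_measurable[OF H] by blast
  have H'2: "H' \<in> borel_measurable (lborel \<Otimes>\<^sub>M lborel)"
    using H' by (simp add: lborel_prod)
  have "AE x in lebesgue. AE y in lebesgue. H (x, y) = H' (x, y)"
    using AE_lebesgue_fst_snd[of "\<lambda>x y. H (x, y) = H' (x, y)"] ae by (simp add: AE_completion_iff)
  then have eq: "AE x in lebesgue. (\<integral>\<^sup>+y. H (x, y) \<partial>lebesgue) = (\<integral>\<^sup>+y. H' (x, y) \<partial>lborel)"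
    by eventually_elim (auto simp: nn_integral_completion AE_completion_iff intro: nn_integral_cong_AE)
  have m: "(\<lambda>x. \<integral>\<^sup>+y. H' (x, y) \<partial>lborel) \<in> borel_measurable lebesgue"
    using lborel.borel_measurable_nn_integral_fst[OF H'2] by (intro measurable_completion) simp
  show "(\<lambda>x. \<integral>\<^sup>+y. H (x, y) \<partial>lebesgue) \<in> borel_measurable lebesgue"
    using borel_measurable_lebesgue_AE_cong[OF m eq] .
  have "(\<integral>\<^sup>+z. H z \<partial>lebesgue) = (\<integral>\<^sup>+z. H' z \<partial>(lborel \<Otimes>\<^sub>M lborel))"
    using ae by (simp add: nn_integral_completion lborel_prod nn_integral_cong_AE)
  also have "\<dots> = (\<integral>\<^sup>+x. \<integral>\<^sup>+y. H' (x, y) \<partial>lborel \<partial>lborel)"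
    by (simp add: lborel.nn_integral_fst[OF H'2])
  also have "\<dots> = (\<integral>\<^sup>+x. \<integral>\<^sup>+y. H (x, y) \<partial>lebesgue \<partial>lebesgue)"
    unfolding nn_integral_completion[symmetric, of lborel "\<lambda>x. \<integral>\<^sup>+y. H' (x, y) \<partial>lborel"]
    using eq by (intro nn_integral_cong_AE) auto
  finally show "(\<integral>\<^sup>+z. H z \<partial>lebesgue) = (\<integral>\<^sup>+x. \<integral>\<^sup>+y. H (x, y) \<partial>lebesgue \<partial>lebesgue)" .
qed

text \<open>Measurability between completions requires, besides Borel measurability, that preimages
  of null sets are null; here these are the cylinders \<open>N \<times> UNIV\<close>.\<close>

lemma measurable_lebesgue_fst:
  "(fst :: 'b::euclidean_space \<times> 'c::euclidean_space \<Rightarrow> 'b) \<in> lebesgue \<rightarrow>\<^sub>M lebesgue"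
proof (rule completion.measurable_completion2)
  show m: "(fst :: 'b \<times> 'c \<Rightarrow> 'b) \<in> lebesgue \<rightarrow>\<^sub>M lborel"
    by (intro measurable_completion) (simp add: borel_measurable_continuous_onI continuous_on_fst)
  show "null_sets lborel \<subseteq> null_sets (distr lebesgue lborel (fst :: 'b \<times> 'c \<Rightarrow> 'b))"
  proof
    fix N :: "'b set" assume N: "N \<in> null_sets lborel"
    then have Ns: "N \<in> sets borel" by (simp add: null_sets_def)
    have "emeasure lborel (N \<times> (UNIV::'c set)) = emeasure (lborel \<Otimes>\<^sub>M lborel) (N \<times> (UNIV::'c set))"
      by (simp add: lborel_prod)
    also have "\<dots> = 0"
      using N Ns by (subst lborel.emeasure_pair_measure_Times) (auto simp: null_sets_def)
    finally have "emeasure lebesgue (N \<times> (UNIV::'c set)) = 0"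
      using Ns by (subst emeasure_completion) (auto simp: borel_Times)
    moreover have "(fst :: 'b \<times> 'c \<Rightarrow> 'b) -` N = N \<times> UNIV" by auto
    ultimately show "N \<in> null_sets (distr lebesgue lborel (fst :: 'b \<times> 'c \<Rightarrow> 'b))"
      using Ns by (simp add: null_sets_def emeasure_distr[OF m])
  qed
qed

lemma measurable_lebesgue_snd:
  "(snd :: 'b::euclidean_space \<times> 'c::euclidean_space \<Rightarrow> 'c) \<in> lebesgue \<rightarrow>\<^sub>M lebesgue"
proof (rule completion.measurable_completion2)
  show m: "(snd :: 'b \<times> 'c \<Rightarrow> 'c) \<in> lebesgue \<rightarrow>\<^sub>M lborel"
    by (intro measurable_completion) (simp add: borel_measurable_continuous_onI continuous_on_snd)
  show "null_sets lborel \<subseteq> null_sets (distr lebesgue lborel (snd :: 'b \<times> 'c \<Rightarrow> 'c))"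
  proof
    fix N :: "'c set" assume N: "N \<in> null_sets lborel"
    then have Ns: "N \<in> sets borel" by (simp add: null_sets_def)
    have "emeasure lborel ((UNIV::'b set) \<times> N) = emeasure (lborel \<Otimes>\<^sub>M lborel) ((UNIV::'b set) \<times> N)"
      by (simp add: lborel_prod)
    also have "\<dots> = 0"
      using N Ns by (subst lborel.emeasure_pair_measure_Times) (auto simp: null_sets_def)
    finally have "emeasure lebesgue ((UNIV::'b set) \<times> N) = 0"
      using Ns by (subst emeasure_completion) (auto simp: borel_Times)
    moreover have "(snd :: 'b \<times> 'c \<Rightarrow> 'c) -` N = UNIV \<times> N" by auto
    ultimately show "N \<in> null_sets (distr lebesgue lborel (snd :: 'b \<times> 'c \<Rightarrow> 'c))"
      using Ns by (simp add: null_sets_def emeasure_distr[OF m])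
  qed
qed

lemma borel_measurable_kernel:
  "(\<lambda>z::'a::euclidean_space \<times> 'a. norm (fst z - snd z) powr e) \<in> borel_measurable lebesgue"
proof (intro measurable_completion)
  have [measurable]: "(\<lambda>z::'a \<times> 'a. fst z - snd z) \<in> borel_measurable borel"
    by (intro borel_measurable_continuous_onI continuous_intros)
  show "(\<lambda>z::'a \<times> 'a. norm (fst z - snd z) powr e) \<in> borel_measurable lborel"
    unfolding measurable_lborel1 by measurable
qed

lemma borel_measurable_difference_quotient:
  fixes z :: "'a::euclidean_space \<Rightarrow> real"
  assumes z: "z \<in> borel_measurable lebesgue"
  shows "(\<lambda>w. \<bar>z (fst w) - z (snd w)\<bar> powr p / norm (fst w - snd w) powr e) \<in> borel_measurable lebesgue"
proof -
  have [measurable]: "(\<lambda>w::'a \<times> 'a. z (fst w)) \<in> borel_measurable lebesgue"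
    "(\<lambda>w::'a \<times> 'a. z (snd w)) \<in> borel_measurable lebesgue"
    using measurable_compose[OF measurable_lebesgue_fst z] measurable_compose[OF measurable_lebesgue_snd z] by auto
  note borel_measurable_kernel[measurable]
  show ?thesis by measurable
qed

section \<open>Fractional Poincare and Sobolev inequalities\<close>

lemma ex_disjoint_ball:
  fixes \<Omega> :: "'a::euclidean_space set"
  assumes "bounded \<Omega>"
  obtains c D where "ball c 1 \<inter> \<Omega> = {}" "0 < D" "\<And>x y. x \<in> \<Omega> \<Longrightarrow> y \<in> ball c 1 \<Longrightarrow> norm (x - y) \<le> D"
proof -
  obtain R where R: "0 < R" "\<And>x. x \<in> \<Omega> \<Longrightarrow> norm x \<le> R"
    using assms by (auto simp: bounded_pos)
  obtain e :: 'a where "e \<in> Basis" using nonempty_Basis by blast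
  then have e: "norm e = 1" by simp
  define c where "c = (R + 1) *\<^sub>R e"
  have c: "norm c = R + 1" using e R by (simp add: c_def)
  show ?thesis
  \<comment> \<open>Points of the unit ball around \<open>c\<close> have norm strictly between
    \<open>R\<close> and \<open>R + 2\<close>. This gives both the disjointness from \<Omega> and
    the distance bound \<open>R + (R + 2)\<close>.\<close>
  proof (rule that[of c "2 * R + 2"])
    show "ball c 1 \<inter> \<Omega> = {}"
    proof (rule ccontr)
      assume "ball c 1 \<inter> \<Omega> \<noteq> {}"
      then obtain x where "norm (c - x) < 1" "x \<in> \<Omega>" by (auto simp: dist_norm)
      then show False using norm_triangle_ineq2[of c x] c R(2)[of x] by simp
    qed
    show "norm (x - y) \<le> 2 * R + 2" if "x \<in> \<Omega>" "y \<in> ball c 1" for x y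
      using that R(2)[of x] norm_triangle_ineq4[of x y] norm_triangle_ineq2[of y c] c
      by (simp add: dist_norm norm_minus_commute)
  qed (use R in auto)
qed

lemma emeasure_lborel_ball: "emeasure lborel (ball (c::'a::euclidean_space) r) = ennreal (measure lborel (ball c r))"
  using emeasure_eq_measure2[OF lmeasurable_ball, of c r] by simp

text \<open>Already the part of the integral over a ball disjoint from \<open>\<Omega>\<close>, where \<open>z\<close> vanishes, suffices.\<close>
lemma fractional_poincare:
  fixes \<Omega> :: "'a::euclidean_space set"
  assumes "bounded \<Omega>" "0 < s" "0 < p"
  shows "\<exists>P>0. \<forall>z x. z \<in> borel_measurable lebesgue \<longrightarrow> (\<forall>x. x \<notin> \<Omega> \<longrightarrow> z x = 0) \<longrightarrow>
       ennreal (P * \<bar>z x\<bar> powr p)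
       \<le> (\<integral>\<^sup>+y. ennreal (\<bar>z x - z y\<bar> powr p / norm (x - y) powr (real DIM('a) + s * p)) \<partial>lebesgue)"
proof -
  obtain c D where cD: "ball c 1 \<inter> \<Omega> = {}" "0 < D" "\<And>x y. x \<in> \<Omega> \<Longrightarrow> y \<in> ball c 1 \<Longrightarrow> norm (x - y) \<le> D"
    using ex_disjoint_ball[OF assms(1)] by metis
  define e where "e = real DIM('a) + s * p"
  have e: "0 < e" using assms by (auto simp: e_def intro: add_pos_pos)
  define P where "P = measure lebesgue (ball c 1) / D powr e"
  show ?thesis
  proof (intro exI[of _ P] conjI allI impI)
    show "0 < P" using cD by (simp add: P_def)
    fix z :: "'a \<Rightarrow> real" and x assume z: "z \<in> borel_measurable lebesgue" and z0: "\<forall>x. x \<notin> \<Omega> \<longrightarrow> z x = 0"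
    let ?g = "\<integral>\<^sup>+y. ennreal (\<bar>z x - z y\<bar> powr p / norm (x - y) powr e) \<partial>lebesgue"
    show "ennreal (P * \<bar>z x\<bar> powr p) \<le> (\<integral>\<^sup>+y. ennreal (\<bar>z x - z y\<bar> powr p / norm (x - y) powr (real DIM('a) + s * p)) \<partial>lebesgue)"
    proof (cases "x \<in> \<Omega>")
      case True
      have "ennreal (P * \<bar>z x\<bar> powr p) = ennreal (\<bar>z x\<bar> powr p / D powr e) * ennreal (measure lebesgue (ball c 1))"
        by (simp add: P_def mult.commute flip: ennreal_mult)
      also have "\<dots> = (\<integral>\<^sup>+y. ennreal (\<bar>z x\<bar> powr p / D powr e) * indicator (ball c 1) y \<partial>lebesgue)"
        by (subst nn_integral_cmult_indicator) (auto simp: emeasure_lborel_ball)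
      also have "\<dots> \<le> ?g"
      proof (rule nn_integral_mono)
        fix y
        show "ennreal (\<bar>z x\<bar> powr p / D powr e) * indicator (ball c 1) y \<le> ennreal (\<bar>z x - z y\<bar> powr p / norm (x - y) powr e)"
        proof (cases "y \<in> ball c 1")
          case y: True
          then have "y \<notin> \<Omega>" "norm (x - y) \<le> D" using cD True by auto
          then have "0 < norm (x - y)" "z y = 0" "norm (x - y) powr e \<le> D powr e"
            using True e z0 by (auto intro: powr_mono2)
          then show ?thesis using y cD by (auto intro!: ennreal_leI divide_left_mono mult_pos_pos)
        qed simp
      qed
      finally show ?thesis by (simp add: e_def)
    qed (simp add: z0)
  qed
qed

text \<open>The bound \<open>|z x| powr p <= 2 powr p * (|z y| powr p + |z x - z y| powr p)\<close>
  is integrated over \<open>y\<close> in the ball of radius \<rho> around \<open>x\<close>. There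
  \<open>norm (x - y)\<close> is below \<rho>, so the last term is at most
  \<open>\<rho> powr (d + s * p)\<close> times the difference quotient of the seminorm.\<close>

lemma ball_average_estimate:
  fixes z :: "'a::euclidean_space \<Rightarrow> real"
  assumes z: "z \<in> borel_measurable lebesgue" and "0 < p" "0 < s" "0 < \<rho>"
  shows "ennreal (\<bar>z x\<bar> powr p * (measure lebesgue (ball (0::'a) 1) * \<rho> powr real DIM('a)))
     \<le> ennreal (2 powr p) * (\<integral>\<^sup>+y. ennreal (\<bar>z y\<bar> powr p) \<partial>lebesgue)
      + ennreal (2 powr p * \<rho> powr (real DIM('a) + s * p)) *
        (\<integral>\<^sup>+y. ennreal (\<bar>z x - z y\<bar> powr p / norm (x - y) powr (real DIM('a) + s * p)) \<partial>lebesgue)"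
proof -
  define e where "e = real DIM('a) + s * p"
  have e: "0 < e" using assms by (auto simp: e_def intro: add_pos_pos)
  note z[measurable]
  have [measurable]: "(\<lambda>y. norm (x - y) powr e) \<in> borel_measurable lebesgue"
    by (intro measurable_completion) simp
  have "measure lebesgue (ball (0::'a) 1) * \<rho> powr real DIM('a) = measure lebesgue (ball x \<rho>)"
    using assms content_ball_conv_unit_ball[of \<rho> x] by (simp add: powr_realpow mult.commute)
  then have "ennreal (\<bar>z x\<bar> powr p * (measure lebesgue (ball (0::'a) 1) * \<rho> powr real DIM('a)))
      = ennreal (\<bar>z x\<bar> powr p) * emeasure lebesgue (ball x \<rho>)"
    by (simp add: ennreal_mult emeasure_lborel_ball)
  also have "\<dots> = (\<integral>\<^sup>+y. ennreal (\<bar>z x\<bar> powr p) * indicator (ball x \<rho>) y \<partial>lebesgue)"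
    by (subst nn_integral_cmult_indicator) auto
  also have "\<dots> \<le> (\<integral>\<^sup>+y. ennreal (2 powr p) * ennreal (\<bar>z y\<bar> powr p)
      + ennreal (2 powr p * \<rho> powr e) * ennreal (\<bar>z x - z y\<bar> powr p / norm (x - y) powr e) \<partial>lebesgue)"
  proof (rule nn_integral_mono)
    fix y
    have "\<bar>z x\<bar> powr p \<le> 2 powr p * \<bar>z y\<bar> powr p + (2 powr p * \<rho> powr e) * (\<bar>z x - z y\<bar> powr p / norm (x - y) powr e)"
      if "y \<in> ball x \<rho>"
    proof -
      have "\<bar>z x\<bar> powr p \<le> (\<bar>z y\<bar> + \<bar>z x - z y\<bar>) powr p"
        using assms by (intro powr_mono2) auto
      also have "\<dots> \<le> 2 powr p * (\<bar>z y\<bar> powr p + \<bar>z x - z y\<bar> powr p)"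
        using assms by (intro add_powr_le) auto
      \<comment> \<open>On the diagonal the quotient is \<open>0 / 0 = 0\<close>, and the left-hand
        side vanishes as well.\<close>
      also have "\<bar>z x - z y\<bar> powr p \<le> \<rho> powr e * (\<bar>z x - z y\<bar> powr p / norm (x - y) powr e)"
      proof (cases "x = y")
        case False
        have "norm (x - y) powr e \<le> \<rho> powr e"
          using that e by (intro powr_mono2) (auto simp: dist_norm)
        then have "norm (x - y) powr e * \<bar>z x - z y\<bar> powr p \<le> \<rho> powr e * \<bar>z x - z y\<bar> powr p"
          by (intro mult_right_mono) auto
        then show ?thesis using False by (simp add: field_simps)
      qed simp
      finally show ?thesis by (simp add: algebra_simps)
    qed
    then show "ennreal (\<bar>z x\<bar> powr p) * indicator (ball x \<rho>) y \<le> ennreal (2 powr p) * ennreal (\<bar>z y\<bar> powr p)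
      + ennreal (2 powr p * \<rho> powr e) * ennreal (\<bar>z x - z y\<bar> powr p / norm (x - y) powr e)"
      by (auto simp: indicator_def simp flip: ennreal_mult ennreal_plus intro!: ennreal_leI)
  qed
  also have "\<dots> = ennreal (2 powr p) * (\<integral>\<^sup>+y. ennreal (\<bar>z y\<bar> powr p) \<partial>lebesgue)
      + ennreal (2 powr p * \<rho> powr e) *
        (\<integral>\<^sup>+y. ennreal (\<bar>z x - z y\<bar> powr p / norm (x - y) powr e) \<partial>lebesgue)"
    by (subst nn_integral_add) (auto simp: nn_integral_cmult)
  finally show ?thesis by (simp add: e_def)
qed

text \<open>The radius makes the first term on the right of the ball average estimate half of the left-hand side.\<close>
lemma optimal_radius:
  fixes d e t w B G c :: real
  assumes "0 < d" "0 < e" "0 \<le> t" "0 < w" "0 < B" "0 < c" "0 \<le> G"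
    and est: "\<And>\<rho>. 0 < \<rho> \<Longrightarrow> t * (w * \<rho> powr d) \<le> c * B + c * \<rho> powr (d + e) * G"
  shows "t powr (1 + e / d) \<le> 2 * c / w * (2 * c / w * B) powr (e / d) * G"
proof (cases "t = 0")
  case False
  then have t: "0 < t" using assms by auto
  define \<rho> where "\<rho> = (2 * c / w * B / t) powr (1 / d)"
  have \<rho>: "0 < \<rho>" using t assms by (simp add: \<rho>_def)
  have \<rho>d: "\<rho> powr d = 2 * c / w * B / t" using t assms by (simp add: \<rho>_def powr_powr)
  have \<rho>e: "\<rho> powr e = (2 * c / w * B) powr (e / d) / t powr (e / d)"
    using t assms by (simp add: \<rho>_def powr_powr powr_divide powr_mult)
  have "t * (w * \<rho> powr d) = 2 * c * B" using t assms by (simp add: \<rho>d)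
  then have "t * (w * \<rho> powr d) \<le> 2 * (c * \<rho> powr (d + e) * G)"
    using est[OF \<rho>] by linarith
  also have "\<dots> = \<rho> powr d * (2 * c * \<rho> powr e * G)"
    by (simp add: powr_add)
  finally have "\<rho> powr d * (t * w) \<le> \<rho> powr d * (2 * c * \<rho> powr e * G)"
    by (simp add: mult_ac)
  then have "t * w \<le> 2 * c * \<rho> powr e * G" using \<rho> by simp
  then have "t * w * t powr (e / d) \<le> 2 * c * \<rho> powr e * G * t powr (e / d)"
    by (intro mult_right_mono) auto
  also have "\<dots> = 2 * c * (2 * c / w * B) powr (e / d) * G"
    using t by (simp add: \<rho>e)
  finally have "t powr (e / d) * t \<le> 2 * c / w * (2 * c / w * B) powr (e / d) * G"
    using assms by (simp add: field_simps)
  then show ?thesis using t by (simp add: powr_add mult.commute)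
qed (use assms in simp)

text \<open>A Hedberg-type argument. Poincare bounds the integral of \<open>|z| powr p\<close> by a
  multiple of \<open>A\<close>; the ball average at the optimal radius then bounds
  \<open>(|z x| powr p) powr k0\<close> pointwise by \<open>K * A powr (s * p / d)\<close> times the
  inner integral of the seminorm, and integration in \<open>x\<close> yields the exponent
  \<open>k0 = 1 + s * p / d\<close>. Smaller exponents follow by interpolation on the bounded set.
  The gain is below the sharp Sobolev one, but \<open>s * p < d\<close> and
  \<open>s * p >= d\<close> are treated alike.\<close>

lemma fractional_sobolev:
  fixes \<Omega> :: "'a::euclidean_space set"
  assumes \<Omega>: "bounded \<Omega>" "\<Omega> \<in> sets lebesgue" and sp: "0 < s" "0 < p"
    and k: "0 < k" "k \<le> 1 + s * p / real DIM('a)"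
  shows "\<exists>C>0. \<forall>z A. z \<in> borel_measurable lebesgue \<longrightarrow> (\<forall>x. x \<notin> \<Omega> \<longrightarrow> z x = 0) \<longrightarrow> 0 < A \<longrightarrow>
      gagliardo s p z \<le> ennreal A \<longrightarrow>
      (\<integral>\<^sup>+x. ennreal (\<bar>z x\<bar> powr (p * k)) \<partial>lebesgue) \<le> ennreal (C * A powr k)"
proof -
  obtain P where P: "0 < P"
    "\<And>z x. z \<in> borel_measurable lebesgue \<Longrightarrow> \<forall>x. x \<notin> \<Omega> \<longrightarrow> z x = 0 \<Longrightarrow>
       ennreal (P * \<bar>z x\<bar> powr p)
       \<le> (\<integral>\<^sup>+y. ennreal (\<bar>z x - z y\<bar> powr p / norm (x - y) powr (real DIM('a) + s * p)) \<partial>lebesgue)"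
    using fractional_poincare[OF \<Omega>(1) sp] by blast
  define w where "w = measure lebesgue (ball (0::'a) 1)"
  have w: "0 < w" by (simp add: w_def)
  define d where "d = real DIM('a)"
  have d: "0 < d" by (simp add: d_def)
  define k0 where "k0 = 1 + s * p / d"
  have k0: "0 < k0" using sp d by (auto simp: k0_def intro: add_pos_pos)
  define c where "c = 2 powr p"
  have c: "0 < c" by (simp add: c_def)
  \<comment> \<open>The constant of \<open>optimal_radius\<close> at \<open>B = 1 / P\<close>; for
    \<open>B = A / P\<close> the factor \<open>A powr (s * p / d)\<close> splits off.\<close>
  define K where "K = 2 * c / w * (2 * c / w * (1 / P)) powr (s * p / d)"
  have K: "0 < K" using w P c by (simp add: K_def)
  have lm: "\<Omega> \<in> lmeasurable" using \<Omega> by (simp add: bounded_set_imp_lmeasurable)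
  show ?thesis
  proof (intro exI[of _ "measure lebesgue \<Omega> + K"] conjI allI impI)
    show "0 < measure lebesgue \<Omega> + K" using K by (simp add: add_nonneg_pos)
    fix z :: "'a \<Rightarrow> real" and A assume z: "z \<in> borel_measurable lebesgue"
      and z0: "\<forall>x. x \<notin> \<Omega> \<longrightarrow> z x = 0" and A: "0 < A" and gag: "gagliardo s p z \<le> ennreal A"
    note z[measurable]
    let ?H = "\<lambda>w. ennreal (\<bar>z (fst w) - z (snd w)\<bar> powr p / norm (fst w - snd w) powr (d + s * p))"
    let ?g = "\<lambda>x. \<integral>\<^sup>+y. ennreal (\<bar>z x - z y\<bar> powr p / norm (x - y) powr (d + s * p)) \<partial>lebesgue"
    have Hm: "?H \<in> borel_measurable lebesgue"
      using borel_measurable_difference_quotient[OF z] by simp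
    have gm [measurable]: "?g \<in> borel_measurable lebesgue"
      using nn_integral_lebesgue_prod(1)[OF Hm] by simp
    have gA: "(\<integral>\<^sup>+x. ?g x \<partial>lebesgue) \<le> ennreal A"
      using nn_integral_lebesgue_prod(2)[OF Hm] gag by (simp add: gagliardo_def d_def)
    have "ennreal P * (\<integral>\<^sup>+x. ennreal (\<bar>z x\<bar> powr p) \<partial>lebesgue) = (\<integral>\<^sup>+x. ennreal (P * \<bar>z x\<bar> powr p) \<partial>lebesgue)"
      using P by (simp add: ennreal_mult nn_integral_cmult)
    also have "\<dots> \<le> (\<integral>\<^sup>+x. ?g x \<partial>lebesgue)"
      using P(2)[OF z z0] by (intro nn_integral_mono) (simp add: d_def)
    also note gA
    finally have "ennreal (1 / P) * (ennreal P * (\<integral>\<^sup>+x. ennreal (\<bar>z x\<bar> powr p) \<partial>lebesgue)) \<le> ennreal (1 / P) * ennreal A"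
      by (intro mult_left_mono) auto
    then have B: "(\<integral>\<^sup>+x. ennreal (\<bar>z x\<bar> powr p) \<partial>lebesgue) \<le> ennreal (A / P)"
      using P A by (simp add: mult.assoc[symmetric] flip: ennreal_mult)
    \<comment> \<open>The inner integral may be infinite at some \<open>x\<close>; there the
      right-hand side is infinite too, because its coefficient is positive.\<close>
    have pw: "ennreal ((\<bar>z x\<bar> powr p) powr k0) \<le> ennreal (K * A powr (s * p / d)) * ?g x" for x
    proof (cases "?g x = \<infinity>")
      case True
      have "0 < K * A powr (s * p / d)" using K A by simp
      then show ?thesis unfolding True using K A by (simp add: ennreal_mult_top)
    next
      case False
      then obtain G where G: "0 \<le> G" "?g x = ennreal G"
        by (cases "?g x") auto
      have "(\<bar>z x\<bar> powr p) powr (1 + s * p / d) \<le> 2 * c / w * (2 * c / w * (A / P)) powr (s * p / d) * G"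
      proof (rule optimal_radius)
        fix \<rho> :: real assume \<rho>: "0 < \<rho>"
        have "ennreal (\<bar>z x\<bar> powr p * (w * \<rho> powr d)) \<le> ennreal c * (\<integral>\<^sup>+y. ennreal (\<bar>z y\<bar> powr p) \<partial>lebesgue)
          + ennreal (c * \<rho> powr (d + s * p)) * ?g x"
          using ball_average_estimate[OF z sp(2,1) \<rho>, of x] by (simp add: w_def d_def c_def)
        also have "\<dots> \<le> ennreal c * ennreal (A / P) + ennreal (c * \<rho> powr (d + s * p)) * ennreal G"
          unfolding G(2) by (intro add_mono mult_left_mono B) auto
        also have "\<dots> = ennreal (c * (A / P) + c * \<rho> powr (d + s * p) * G)"
          using c A P G by (simp flip: ennreal_mult ennreal_plus)
        finally show "\<bar>z x\<bar> powr p * (w * \<rho> powr d) \<le> c * (A / P) + c * \<rho> powr (d + s * p) * G"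
          using c A P G by (subst (asm) ennreal_le_iff) auto
      qed (use d sp w A P c G in auto)
      also have "\<dots> = K * A powr (s * p / d) * G"
        by (simp add: K_def powr_mult powr_divide)
      finally show ?thesis unfolding G(2)
        using K G by (simp add: k0_def flip: ennreal_mult)
    qed
    have "(\<integral>\<^sup>+x. ennreal ((\<bar>z x\<bar> powr p) powr k0) \<partial>lebesgue) \<le> (\<integral>\<^sup>+x. ennreal (K * A powr (s * p / d)) * ?g x \<partial>lebesgue)"
      by (intro nn_integral_mono pw)
    also have "\<dots> = ennreal (K * A powr (s * p / d)) * (\<integral>\<^sup>+x. ?g x \<partial>lebesgue)"
      by (rule nn_integral_cmult) measurable
    also have "\<dots> \<le> ennreal (K * A powr (s * p / d)) * ennreal A"
      by (intro mult_left_mono gA) auto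
    also have "\<dots> = ennreal (K * A powr k0)"
      using K A by (simp add: k0_def powr_add mult_ac flip: ennreal_mult)
    finally have I0: "(\<integral>\<^sup>+x. ennreal ((\<bar>z x\<bar> powr p) powr k0) \<partial>lebesgue) \<le> ennreal (K * A powr k0)" .
    define a where "a = k / k0"
    have a: "0 < a" "a \<le> 1" using k k0 by (auto simp: a_def k0_def d_def)
    \<comment> \<open>Interpolation by the tangent line of the concave power \<open>a\<close> at
      \<open>A powr k0\<close>, the scale at which both terms integrate to multiples of
      \<open>A powr k\<close>. The indicator is where the finite measure of \<Omega> enters.\<close>
    have pw2: "ennreal (\<bar>z x\<bar> powr (p * k))
       \<le> ennreal (A powr k) * indicator \<Omega> x + ennreal (A powr k / A powr k0) * ennreal ((\<bar>z x\<bar> powr p) powr k0)" for x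
    proof (cases "x \<in> \<Omega>")
      case True
      let ?t = "(\<bar>z x\<bar> powr p) powr k0"
      have "\<bar>z x\<bar> powr (p * k) = ?t powr a"
        using k0 by (simp add: powr_powr a_def)
      also have "\<dots> \<le> (A powr k0) powr a * (1 - a + a * (?t / A powr k0))"
        using a A by (intro powr_concave_tangent) auto
      also have "\<dots> \<le> (A powr k0) powr a * (1 + 1 * (?t / A powr k0))"
        using a by (intro mult_left_mono add_mono mult_right_mono) auto
      also have "\<dots> = A powr k + A powr k / A powr k0 * ?t"
        using k0 by (simp add: powr_powr a_def algebra_simps)
      finally show ?thesis using True
        by (simp flip: ennreal_mult ennreal_plus)
    qed (simp add: z0)
    have "(\<integral>\<^sup>+x. ennreal (\<bar>z x\<bar> powr (p * k)) \<partial>lebesgue)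
      \<le> (\<integral>\<^sup>+x. ennreal (A powr k) * indicator \<Omega> x + ennreal (A powr k / A powr k0) * ennreal ((\<bar>z x\<bar> powr p) powr k0) \<partial>lebesgue)"
      by (intro nn_integral_mono pw2)
    also have "\<dots> = ennreal (A powr k) * emeasure lebesgue \<Omega> + ennreal (A powr k / A powr k0) * (\<integral>\<^sup>+x. ennreal ((\<bar>z x\<bar> powr p) powr k0) \<partial>lebesgue)"
      using \<Omega> by (subst nn_integral_add) (auto simp: nn_integral_cmult nn_integral_cmult_indicator)
    also have "\<dots> \<le> ennreal (A powr k) * ennreal (measure lebesgue \<Omega>) + ennreal (A powr k / A powr k0) * ennreal (K * A powr k0)"
      using lm by (intro add_mono mult_left_mono I0) (auto simp: emeasure_eq_measure2)
    also have "\<dots> = ennreal ((measure lebesgue \<Omega> + K) * A powr k)"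
      using K A by (simp add: algebra_simps flip: ennreal_mult ennreal_plus)
    finally show "(\<integral>\<^sup>+x. ennreal (\<bar>z x\<bar> powr (p * k)) \<partial>lebesgue) \<le> ennreal ((measure lebesgue \<Omega> + K) * A powr k)" .
  qed
qed

section \<open>The energy estimate\<close>

lemma Lp_on_1_iff_integrable: "Lp_on S 1 f \<longleftrightarrow> integrable (lebesgue_on S) f"
  unfolding Lp_on_def integrable_iff_bounded by simp

lemma gagliardo_lipschitz_le:
  fixes w :: "'a::euclidean_space \<Rightarrow> real"
  assumes w: "w \<in> borel_measurable lebesgue" and "0 < p" "0 \<le> K"
    and G: "\<And>a b. \<bar>G a - G b\<bar> \<le> K * \<bar>a - b\<bar>"
  shows "gagliardo s p (\<lambda>x. G (w x)) \<le> ennreal (K powr p) * gagliardo s p w"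
proof -
  have [measurable]: "(\<lambda>z. \<bar>w (fst z) - w (snd z)\<bar> powr p / norm (fst z - snd z) powr (real DIM('a) + s * p)) \<in> borel_measurable lebesgue"
    using borel_measurable_difference_quotient[OF w] by simp
  have "gagliardo s p (\<lambda>x. G (w x)) \<le> (\<integral>\<^sup>+z. ennreal (K powr p) * ennreal (\<bar>w (fst z) - w (snd z)\<bar> powr p /
        norm (fst z - snd z) powr (real DIM('a) + s * p)) \<partial>(lebesgue :: ('a \<times> 'a) measure))"
    unfolding gagliardo_def
  proof (rule nn_integral_mono)
    fix z :: "'a \<times> 'a"
    have "\<bar>G (w (fst z)) - G (w (snd z))\<bar> powr p \<le> (K * \<bar>w (fst z) - w (snd z)\<bar>) powr p"
      using G assms by (intro powr_mono2) auto
    also have "\<dots> = K powr p * \<bar>w (fst z) - w (snd z)\<bar> powr p"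
      by (simp add: powr_mult)
    finally show "ennreal (\<bar>G (w (fst z)) - G (w (snd z))\<bar> powr p / norm (fst z - snd z) powr (real DIM('a) + s * p))
      \<le> ennreal (K powr p) * ennreal (\<bar>w (fst z) - w (snd z)\<bar> powr p / norm (fst z - snd z) powr (real DIM('a) + s * p))"
      unfolding ennreal_mult'[OF powr_ge_zero, symmetric] times_divide_eq_right
      by (intro ennreal_leI divide_right_mono) auto
  qed
  also have "\<dots> = ennreal (K powr p) * gagliardo s p w"
    unfolding gagliardo_def by (subst nn_integral_cmult) auto
  finally show ?thesis .
qed

text \<open>Provides admissible test functions: a truncated power of \<open>w\<close> is a globally
  Lipschitz function of \<open>w\<close> that vanishes at \<open>0\<close>, even when the power
  itself is superlinear.\<close>

lemma W0_lipschitz_comp: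
  fixes w :: "'a::euclidean_space \<Rightarrow> real"
  assumes w: "W0 \<Omega> s p w" and p: "0 < p" and K: "0 \<le> K"
    and G: "\<And>a b. \<bar>G a - G b\<bar> \<le> K * \<bar>a - b\<bar>" and G0: "G 0 = 0" and Gm: "G \<in> borel_measurable borel"
  shows "W0 \<Omega> s p (\<lambda>x. G (w x))"
proof -
  have m[measurable]: "w \<in> borel_measurable lebesgue"
    and i: "(\<integral>\<^sup>+x. ennreal (\<bar>w x\<bar> powr p) \<partial>lebesgue) < \<infinity>"
    and g: "gagliardo s p w < \<infinity>" and ae: "AE x in lebesgue. x \<notin> \<Omega> \<longrightarrow> w x = 0"
    using w by (auto simp: W0_def Wsp_def Lp_on_def lebesgue_on_UNIV_eq)
  note Gm[measurable]
  have "(\<integral>\<^sup>+x. ennreal (\<bar>G (w x)\<bar> powr p) \<partial>lebesgue) \<le> (\<integral>\<^sup>+x. ennreal (K powr p) * ennreal (\<bar>w x\<bar> powr p) \<partial>lebesgue)"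
  proof (rule nn_integral_mono)
    fix x
    have "\<bar>G (w x)\<bar> powr p \<le> (K * \<bar>w x\<bar>) powr p"
      using G[of "w x" 0] G0 p by (intro powr_mono2) auto
    then show "ennreal (\<bar>G (w x)\<bar> powr p) \<le> ennreal (K powr p) * ennreal (\<bar>w x\<bar> powr p)"
      by (simp add: powr_mult flip: ennreal_mult)
  qed
  also have "\<dots> = ennreal (K powr p) * (\<integral>\<^sup>+x. ennreal (\<bar>w x\<bar> powr p) \<partial>lebesgue)"
    by (subst nn_integral_cmult) auto
  also have "\<dots> < \<infinity>" using i by (simp add: ennreal_mult_less_top)
  finally have 1: "(\<integral>\<^sup>+x. ennreal (\<bar>G (w x)\<bar> powr p) \<partial>lebesgue) < \<infinity>" .
  have "gagliardo s p (\<lambda>x. G (w x)) \<le> ennreal (K powr p) * gagliardo s p w"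
    using m p K G by (rule gagliardo_lipschitz_le)
  also have "\<dots> < \<infinity>" using g by (simp add: ennreal_mult_less_top)
  finally have 2: "gagliardo s p (\<lambda>x. G (w x)) < \<infinity>" .
  have 3: "AE x in lebesgue. x \<notin> \<Omega> \<longrightarrow> G (w x) = 0"
    using ae by eventually_elim (simp add: G0)
  show ?thesis
    using 1 2 3 by (simp add: W0_def Wsp_def Lp_on_def lebesgue_on_UNIV_eq)
qed

text \<open>Pointwise, \<open>spow_monotonicity\<close> is applied to the clipped values and
  \<open>spow_diff_clip_le\<close> restores the full difference in the first factor; then the result
  is integrated against the kernel.\<close>

lemma gagliardo_le_frac_pair:
  fixes w :: "'a::euclidean_space \<Rightarrow> real"
  assumes w: "w \<in> borel_measurable lebesgue" and fin: "gagliardo s p w < \<infinity>"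
    and p: "1 < p" and r: "1 \<le> r" and M: "0 \<le> M" and g: "g = (r + p - 1) / p"
  shows "gagliardo s p (\<lambda>x. spow g (clip M (w x)))
      \<le> ennreal (2 * g powr p * frac_pair s p w (\<lambda>x. spow r (clip M (w x))))"
    and "0 \<le> frac_pair s p w (\<lambda>x. spow r (clip M (w x)))"
proof -
  let ?N = "\<lambda>z::'a \<times> 'a. norm (fst z - snd z) powr (real DIM('a) + s * p)"
  define I where "I z = spow (p - 1) (w (fst z) - w (snd z)) * (spow r (clip M (w (fst z))) - spow r (clip M (w (snd z)))) / ?N z" for z
  have [measurable]: "(\<lambda>z::'a \<times> 'a. w (fst z)) \<in> borel_measurable lebesgue"
    "(\<lambda>z::'a \<times> 'a. w (snd z)) \<in> borel_measurable lebesgue"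
    using measurable_compose[OF measurable_lebesgue_fst w] measurable_compose[OF measurable_lebesgue_snd w] by auto
  note borel_measurable_kernel[measurable]
  have Im [measurable]: "I \<in> borel_measurable lebesgue" unfolding I_def by measurable
  define K where "K = r * M powr (r - 1)"
  have K: "0 \<le> K" using r by (simp add: K_def)
  \<comment> \<open>Integrability has to come first: \<open>frac_pair\<close> is a Bochner integral,
    which would be \<open>0\<close> for a non-integrable integrand. The Lipschitz bound of the test
    function dominates \<open>I\<close> by the integrand of the seminorm.\<close>
  have Ib: "\<bar>I z\<bar> \<le> K * (\<bar>w (fst z) - w (snd z)\<bar> powr p / ?N z)" for z
  proof -
    have "\<bar>spow (p - 1) (w (fst z) - w (snd z)) * (spow r (clip M (w (fst z))) - spow r (clip M (w (snd z))))\<bar>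
      \<le> \<bar>w (fst z) - w (snd z)\<bar> powr (p - 1) * (K * \<bar>w (fst z) - w (snd z)\<bar>)"
      unfolding abs_mult abs_spow K_def using r M
      by (intro mult_left_mono spow_clip_lipschitz) auto
    also have "\<dots> = K * \<bar>w (fst z) - w (snd z)\<bar> powr p"
      using powr_mult_base[of "\<bar>w (fst z) - w (snd z)\<bar>" "p - 1"] by (simp add: mult.commute)
    finally show ?thesis
      unfolding I_def abs_divide times_divide_eq_right by (simp add: divide_right_mono)
  qed
  have "(\<integral>\<^sup>+z. ennreal (norm (I z)) \<partial>lebesgue) \<le> (\<integral>\<^sup>+z. ennreal K * ennreal (\<bar>w (fst z) - w (snd z)\<bar> powr p / ?N z) \<partial>lebesgue)"
    using Ib K by (intro nn_integral_mono) (simp add: ennreal_leI flip: ennreal_mult)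
  also have "\<dots> = ennreal K * gagliardo s p w"
    unfolding gagliardo_def by (rule nn_integral_cmult) measurable
  also have "\<dots> < \<infinity>" using fin by (simp add: ennreal_mult_less_top)
  finally have Ii: "integrable lebesgue I" by (simp add: integrable_iff_bounded)
  have I_ge: "\<bar>spow g (clip M (w (fst z))) - spow g (clip M (w (snd z)))\<bar> powr p / ?N z \<le> 2 * g powr p * I z" for z
  proof -
    have "\<bar>spow g (clip M (w (fst z))) - spow g (clip M (w (snd z)))\<bar> powr p
      \<le> 2 * g powr p * (spow (p - 1) (clip M (w (fst z)) - clip M (w (snd z))) *
          (spow r (clip M (w (fst z))) - spow r (clip M (w (snd z)))))"
      using p r g by (rule spow_monotonicity)
    also have "\<dots> \<le> 2 * g powr p * (spow (p - 1) (w (fst z) - w (snd z)) *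
          (spow r (clip M (w (fst z))) - spow r (clip M (w (snd z)))))"
      using p r by (intro mult_left_mono spow_diff_clip_le) auto
    finally show ?thesis unfolding I_def times_divide_eq_right by (rule divide_right_mono) simp
  qed
  have g0: "0 < g" using p r g by simp
  have I0: "0 \<le> I z" for z
  proof -
    have "0 \<le> 2 * g powr p * I z"
      using I_ge[of z] by (rule order_trans[rotated]) simp
    then show ?thesis using g0 by (simp add: zero_le_mult_iff)
  qed
  have fp: "frac_pair s p w (\<lambda>x. spow r (clip M (w x))) = (\<integral>z. I z \<partial>lebesgue)"
    unfolding frac_pair_def I_def ..
  show "0 \<le> frac_pair s p w (\<lambda>x. spow r (clip M (w x)))"
    unfolding fp using I0 by (intro integral_nonneg_AE) auto
  have "gagliardo s p (\<lambda>x. spow g (clip M (w x))) \<le> (\<integral>\<^sup>+z. ennreal (2 * g powr p) * ennreal (I z) \<partial>lebesgue)"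
    unfolding gagliardo_def using I_ge I0 by (intro nn_integral_mono) (simp add: ennreal_leI flip: ennreal_mult)
  also have "\<dots> = ennreal (2 * g powr p) * (\<integral>\<^sup>+z. ennreal (I z) \<partial>lebesgue)"
    by (rule nn_integral_cmult) measurable
  also have "(\<integral>\<^sup>+z. ennreal (I z) \<partial>lebesgue) = ennreal (\<integral>z. I z \<partial>lebesgue)"
    using Ii I0 by (intro nn_integral_eq_integral) auto
  finally show "gagliardo s p (\<lambda>x. spow g (clip M (w x)))
      \<le> ennreal (2 * g powr p * frac_pair s p w (\<lambda>x. spow r (clip M (w x))))"
    unfolding fp using I0 by (simp add: ennreal_mult Bochner_Integration.integral_nonneg)
qed

lemma integrable_bounded_comp:
  assumes "finite_measure M" and f: "f \<in> borel_measurable M" and b: "\<And>x. \<bar>f x\<bar> \<le> (B::real)"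
  shows "integrable M f"
  using assms by (intro finite_measure.integrable_const_bound[of M f B]) auto

text \<open>With \<open>w = [U]^m\<close>, the test function is \<open>[clip M w]^r\<close> and the
  Sobolev inequality is applied to \<open>z = [clip M w]^g\<close>; since
  \<open>g * (p * k) = r + 1/m\<close>, the power \<open>p * k\<close> of \<open>|z|\<close> is
  \<open>|clip L U| powr (r * m + 1)\<close>. The constant is found before \<open>U\<close> and
  \<open>L\<close>, hence is uniform in the truncation level.\<close>

lemma energy_estimate:
  fixes \<Omega> :: "'a::euclidean_space set"
  assumes \<Omega>: "bounded \<Omega>" "\<Omega> \<in> sets lebesgue" and s: "0 < s" and p: "1 < p" and m: "0 < m"
    and r: "1 \<le> r" and k: "(r + 1 / m) / (r + p - 1) \<le> 1 + s * p / real DIM('a)"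
  shows "\<exists>c>0. \<forall>U F L. A_rel \<Omega> s p m U F \<longrightarrow> 0 < L \<longrightarrow>
     c * (\<integral>x. \<bar>clip L (U x)\<bar> powr (r * m + 1) \<partial>lebesgue_on \<Omega>) powr ((r + p - 1) / (r + 1 / m))
       \<le> (\<integral>x. F x * spow (r * m) (clip L (U x)) \<partial>lebesgue_on \<Omega>)"
proof -
  define k where "k = (r + 1 / m) / (r + p - 1)"
  define g where "g = (r + p - 1) / p"
  have rp: "0 < r + p - 1" using r p by simp
  have rm: "0 < r + 1 / m" using r m by (auto intro: add_pos_pos)
  have k0: "0 < k" using rp rm by (simp add: k_def)
  have g0: "0 < g" using rp p by (simp add: g_def)
  have ik: "(r + p - 1) / (r + 1 / m) = 1 / k" by (simp add: k_def)
  have gpk: "g * (p * k) = r + 1 / m" using rp p by (simp add: g_def k_def)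
  have p0: "0 < p" using p by simp
  obtain C where C: "0 < C" "\<And>z A. z \<in> borel_measurable lebesgue \<Longrightarrow> \<forall>x. x \<notin> \<Omega> \<longrightarrow> z x = 0 \<Longrightarrow> 0 < A \<Longrightarrow>
      gagliardo s p z \<le> ennreal A \<Longrightarrow>
      (\<integral>\<^sup>+x. ennreal (\<bar>z x\<bar> powr (p * k)) \<partial>lebesgue) \<le> ennreal (C * A powr k)"
    using fractional_sobolev[OF \<Omega> s p0 k0] assms(7) unfolding k_def by blast
  have fm: "finite_measure (lebesgue_on \<Omega>)"
    using \<Omega> by (intro finite_measure_lebesgue_on bounded_set_imp_lmeasurable)
  \<comment> \<open>The Sobolev inequality to the power \<open>1 / k\<close> contributes
    \<open>C powr (1 / k)\<close>; the comparison of the seminorm with the pairing contributes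
    \<open>2 * g powr p\<close>.\<close>
  define K where "K = C powr (1 / k) * (2 * g powr p)"
  have K: "0 < K" using C g0 by (simp add: K_def)
  show ?thesis
  proof (intro exI[of _ "1 / K"] conjI allI impI)
    show "0 < 1 / K" using K by simp
    fix U F :: "'a \<Rightarrow> real" and L :: real assume A: "A_rel \<Omega> s p m U F" and L: "0 < L"
    define w where "w x = (if x \<in> \<Omega> then spow m (U x) else 0)" for x
    define M where "M = L powr m"
    have M: "0 < M" using L by (simp add: M_def)
    have w0: "W0 \<Omega> s p w"
      and eq: "\<And>\<phi>. W0 \<Omega> s p \<phi> \<Longrightarrow> Linf_on UNIV \<phi> \<Longrightarrow> frac_pair s p w \<phi> = (\<integral>x. F x * \<phi> x \<partial>lebesgue_on \<Omega>)"
      and Um[measurable]: "U \<in> borel_measurable (lebesgue_on \<Omega>)"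
      using A unfolding A_rel_def w_def Lp_on_def by auto
    have wm[measurable]: "w \<in> borel_measurable lebesgue" and wg: "gagliardo s p w < \<infinity>"
      using w0 by (auto simp: W0_def Wsp_def Lp_on_def lebesgue_on_UNIV_eq)
    define \<phi> where "\<phi> x = spow r (clip M (w x))" for x
    have "W0 \<Omega> s p \<phi>"
      unfolding \<phi>_def using w0 p0
    proof (rule W0_lipschitz_comp)
      show "\<bar>spow r (clip M a) - spow r (clip M b)\<bar> \<le> r * M powr (r - 1) * \<bar>a - b\<bar>" for a b
        using spow_clip_lipschitz r M by auto
    qed (use r M in auto)
    moreover have "Linf_on UNIV \<phi>"
    proof -
      have "\<phi> \<in> borel_measurable lebesgue" unfolding \<phi>_def by measurable
      moreover have "AE x in lebesgue. \<bar>\<phi> x\<bar> \<le> M powr r"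
        unfolding \<phi>_def using abs_spow_clip_le[of M r] r M by auto
      ultimately show ?thesis unfolding Linf_on_def lebesgue_on_UNIV_eq by blast
    qed
    ultimately have E: "frac_pair s p w \<phi> = (\<integral>x. F x * \<phi> x \<partial>lebesgue_on \<Omega>)"
      by (rule eq)
    also have "\<dots> = (\<integral>x. F x * spow (r * m) (clip L (U x)) \<partial>lebesgue_on \<Omega>)"
      using L m by (intro Bochner_Integration.integral_cong)
        (auto simp: \<phi>_def w_def M_def clip_spow spow_spow mult.commute)
    finally have E2: "frac_pair s p w \<phi> = (\<integral>x. F x * spow (r * m) (clip L (U x)) \<partial>lebesgue_on \<Omega>)" .
    define z where "z x = spow g (clip M (w x))" for x
    have zm: "z \<in> borel_measurable lebesgue" unfolding z_def by measurable
    have z0: "\<forall>x. x \<notin> \<Omega> \<longrightarrow> z x = 0" using M by (simp add: z_def w_def)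
    have gz: "gagliardo s p z \<le> ennreal (2 * g powr p * frac_pair s p w \<phi>)"
      and E0: "0 \<le> frac_pair s p w \<phi>"
      unfolding z_def \<phi>_def using gagliardo_le_frac_pair[OF wm wg p r _ g_def, of M] M by auto
    let ?X = "\<integral>x. \<bar>clip L (U x)\<bar> powr (r * m + 1) \<partial>lebesgue_on \<Omega>"
    have X: "ennreal ?X = (\<integral>\<^sup>+x. ennreal (\<bar>z x\<bar> powr (p * k)) \<partial>lebesgue)"
    proof -
      have "integrable (lebesgue_on \<Omega>) (\<lambda>x. \<bar>clip L (U x)\<bar> powr (r * m + 1))"
      proof (rule integrable_bounded_comp[OF fm])
        show "\<bar>\<bar>clip L (U x)\<bar> powr (r * m + 1)\<bar> \<le> L powr (r * m + 1)" for x
          using L r m abs_clip_le[of L "U x"] by (auto intro!: powr_mono2)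
      qed measurable
      then have "ennreal ?X = (\<integral>\<^sup>+x. ennreal (\<bar>clip L (U x)\<bar> powr (r * m + 1)) \<partial>lebesgue_on \<Omega>)"
        by (intro nn_integral_eq_integral[symmetric]) auto
      also have "\<dots> = (\<integral>\<^sup>+x. ennreal (\<bar>z x\<bar> powr (p * k)) \<partial>lebesgue_on \<Omega>)"
      proof (rule nn_integral_cong)
        fix x assume "x \<in> space (lebesgue_on \<Omega>)"
        then have "x \<in> \<Omega>" by simp
        then have "\<bar>z x\<bar> powr (p * k) = (\<bar>clip L (U x)\<bar> powr m) powr (r + 1 / m)"
          using L m unfolding gpk[symmetric] by (simp add: z_def w_def M_def clip_spow powr_powr mult.assoc)
        also have "\<dots> = \<bar>clip L (U x)\<bar> powr (r * m + 1)"
          using m by (simp add: powr_powr algebra_simps)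
        finally show "ennreal (\<bar>clip L (U x)\<bar> powr (r * m + 1)) = ennreal (\<bar>z x\<bar> powr (p * k))" by simp
      qed
      also have "\<dots> = (\<integral>\<^sup>+x. ennreal (\<bar>z x\<bar> powr (p * k)) * indicator \<Omega> x \<partial>lebesgue)"
        using \<Omega> by (intro nn_integral_restrict_space) auto
      also have "\<dots> = (\<integral>\<^sup>+x. ennreal (\<bar>z x\<bar> powr (p * k)) \<partial>lebesgue)"
        using z0 by (intro nn_integral_cong) (auto simp: indicator_def)
      finally show ?thesis .
    qed
    have X0: "0 \<le> ?X" by simp
    have "?X powr (1 / k) \<le> K * frac_pair s p w \<phi>"
    proof (rule field_le_epsilon)
      fix e :: real assume e: "0 < e"
      \<comment> \<open>The Sobolev inequality wants a strictly positive bound, while the pairing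
        may be \<open>0\<close>. The added term is scaled to contribute exactly \<open>e\<close> in
        the end.\<close>
      define A where "A = 2 * g powr p * frac_pair s p w \<phi> + e / C powr (1 / k)"
      have A0: "0 < A" unfolding A_def using e C E0 by (intro add_nonneg_pos) auto
      have "gagliardo s p z \<le> ennreal A"
        using e C by (intro order_trans[OF gz] ennreal_leI) (simp add: A_def)
      then have "ennreal ?X \<le> ennreal (C * A powr k)"
        unfolding X by (rule C(2)[OF zm z0 A0])
      then have "?X \<le> C * A powr k" using C A0 by simp
      then have "?X powr (1 / k) \<le> (C * A powr k) powr (1 / k)"
        using X0 k0 by (intro powr_mono2) auto
      also have "\<dots> = C powr (1 / k) * A" using A0 k0 by (simp add: powr_mult powr_powr)
      also have "\<dots> = K * frac_pair s p w \<phi> + e" using C by (simp add: A_def K_def algebra_simps)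
      finally show "?X powr (1 / k) \<le> K * frac_pair s p w \<phi> + e" .
    qed
    then show "1 / K * ?X powr ((r + p - 1) / (r + 1 / m)) \<le> (\<integral>x. F x * spow (r * m) (clip L (U x)) \<partial>lebesgue_on \<Omega>)"
      unfolding ik E2 using K by (simp add: field_simps)
  qed
qed

section \<open>One step of the implicit Euler scheme\<close>

lemma integrable_mult_bounded:
  fixes f g :: "'b \<Rightarrow> real"
  assumes f: "integrable M f" and g: "g \<in> borel_measurable M" and b: "\<And>x. \<bar>g x\<bar> \<le> B"
  shows "integrable M (\<lambda>x. f x * g x)"
proof (rule Bochner_Integration.integrable_bound)
  show "integrable M (\<lambda>x. B * f x)" using f by simp
  show "(\<lambda>x. f x * g x) \<in> borel_measurable M" using f g by simp
  show "AE x in M. norm (f x * g x) \<le> norm (B * f x)"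
  proof (rule AE_I2)
    fix x
    have "\<bar>f x\<bar> * \<bar>g x\<bar> \<le> \<bar>f x\<bar> * \<bar>B\<bar>"
      using b[of x] by (intro mult_left_mono) auto
    then show "norm (f x * g x) \<le> norm (B * f x)" by (simp add: abs_mult mult.commute)
  qed
qed

lemma integrable_lipschitz_comp:
  fixes f :: "'b \<Rightarrow> real"
  assumes fm: "finite_measure M" and f: "integrable M f" and G: "G \<in> borel_measurable borel"
    and lip: "\<And>a b. \<bar>G a - G b\<bar> \<le> K * \<bar>a - b\<bar>"
  shows "integrable M (\<lambda>x. G (f x))"
proof (rule Bochner_Integration.integrable_bound)
  show "integrable M (\<lambda>x. \<bar>G 0\<bar> + K * \<bar>f x\<bar>)"
    using f by (intro Bochner_Integration.integrable_add finite_measure.integrable_const[OF fm]) simp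
  show "(\<lambda>x. G (f x)) \<in> borel_measurable M"
    using f G by (intro measurable_compose[OF _ G]) simp
  show "AE x in M. norm (G (f x)) \<le> norm (\<bar>G 0\<bar> + K * \<bar>f x\<bar>)"
  proof (rule AE_I2)
    fix x show "norm (G (f x)) \<le> norm (\<bar>G 0\<bar> + K * \<bar>f x\<bar>)"
      using lip[of "f x" 0] by simp
  qed
qed

lemma integral_lipschitz_comp:
  fixes f g :: "'b \<Rightarrow> real"
  assumes fm: "finite_measure M" and f: "integrable M f" and g: "integrable M g"
    and G: "G \<in> borel_measurable borel" and lip: "\<And>a b. \<bar>G a - G b\<bar> \<le> K * \<bar>a - b\<bar>"
  shows "\<bar>(\<integral>x. G (f x) \<partial>M) - (\<integral>x. G (g x) \<partial>M)\<bar> \<le> K * (\<integral>x. \<bar>f x - g x\<bar> \<partial>M)"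
proof -
  have i: "integrable M (\<lambda>x. G (f x))" "integrable M (\<lambda>x. G (g x))"
    using integrable_lipschitz_comp[OF fm _ G lip] f g by auto
  have "\<bar>(\<integral>x. G (f x) \<partial>M) - (\<integral>x. G (g x) \<partial>M)\<bar> = \<bar>\<integral>x. G (f x) - G (g x) \<partial>M\<bar>"
    using i by simp
  also have "\<dots> \<le> (\<integral>x. \<bar>G (f x) - G (g x)\<bar> \<partial>M)" by (rule integral_abs_bound)
  also have "\<dots> \<le> (\<integral>x. K * \<bar>f x - g x\<bar> \<partial>M)"
    using i f g lip by (intro integral_mono) auto
  finally show ?thesis by simp
qed

text \<open>\<open>E\<close> stands for the lower energy bound. The subgradient inequality turns the
  difference quotient times the test function into a difference of integrals of the primitive; its
  sign is right because the scheme is implicit, with the test function taken at the new value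
  \<open>U\<close>.\<close>

lemma implicit_euler_step:
  fixes U U' f :: "'b \<Rightarrow> real"
  assumes fm: "finite_measure M" and U: "integrable M U" and U': "integrable M U'"
    and F: "integrable M (\<lambda>x. f x - (U x - U' x) / h)"
    and h: "0 < h" and L: "0 < L" and l: "1 < l"
    and en: "E \<le> (\<integral>x. (f x - (U x - U' x) / h) * spow (l - 1) (clip L (U x)) \<partial>M)"
  shows "integrable M f"
    and "(\<integral>x. truncated_power l L (U x) \<partial>M) - (\<integral>x. truncated_power l L (U' x) \<partial>M) + h * E
       \<le> h * (\<integral>x. f x * spow (l - 1) (clip L (U x)) \<partial>M)"
proof -
  let ?\<phi> = "\<lambda>x. spow (l - 1) (clip L (U x))"
  have [measurable]: "U \<in> borel_measurable M" using U by simp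
  have \<phi>: "?\<phi> \<in> borel_measurable M" "\<And>x. \<bar>?\<phi> x\<bar> \<le> L powr (l - 1)"
    using abs_spow_clip_le[of L "l - 1"] L l by (measurable, auto)
  \<comment> \<open>Only the combination with the difference quotient is given as integrable;
    \<open>f\<close> is recovered from it.\<close>
  have "integrable M (\<lambda>x. (f x - (U x - U' x) / h) + (U x - U' x) / h)"
    using U U' F by (intro Bochner_Integration.integrable_add) auto
  then show f: "integrable M f" by simp
  have tp: "integrable M (\<lambda>x. truncated_power l L (V x))" if "integrable M V" for V
    by (rule integrable_lipschitz_comp[OF fm that _ truncated_power_lipschitz[OF l L]]) simp
  have i: "integrable M (\<lambda>x. f x * ?\<phi> x)" "integrable M (\<lambda>x. (U x - U' x) * ?\<phi> x)"
    using integrable_mult_bounded[OF _ \<phi>] f U U' by auto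
  have "(\<integral>x. truncated_power l L (U x) \<partial>M) - (\<integral>x. truncated_power l L (U' x) \<partial>M)
      = (\<integral>x. truncated_power l L (U x) - truncated_power l L (U' x) \<partial>M)"
    using tp U U' by simp
  also have "\<dots> \<le> (\<integral>x. (U x - U' x) * ?\<phi> x \<partial>M)"
  proof (rule integral_mono)
    show "truncated_power l L (U x) - truncated_power l L (U' x) \<le> (U x - U' x) * ?\<phi> x" for x
      using truncated_power_subgradient[OF l L, of "U x" "U' x"] by (simp add: algebra_simps)
  qed (use tp U U' i in auto)
  finally have 1: "(\<integral>x. truncated_power l L (U x) \<partial>M) - (\<integral>x. truncated_power l L (U' x) \<partial>M)
     \<le> (\<integral>x. (U x - U' x) * ?\<phi> x \<partial>M)" .
  have "h * E \<le> h * (\<integral>x. (f x - (U x - U' x) / h) * ?\<phi> x \<partial>M)"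
    using en h by (intro mult_left_mono) auto
  also have "(\<integral>x. (f x - (U x - U' x) / h) * ?\<phi> x \<partial>M) = (\<integral>x. f x * ?\<phi> x - (1 / h) * ((U x - U' x) * ?\<phi> x) \<partial>M)"
    by (intro Bochner_Integration.integral_cong) (auto simp: left_diff_distrib diff_divide_distrib)
  also have "\<dots> = (\<integral>x. f x * ?\<phi> x \<partial>M) - (1 / h) * (\<integral>x. (U x - U' x) * ?\<phi> x \<partial>M)"
    using i by (subst Bochner_Integration.integral_diff) (auto simp del: times_divide_eq_left)
  also have "h * \<dots> = h * (\<integral>x. f x * ?\<phi> x \<partial>M) - (\<integral>x. (U x - U' x) * ?\<phi> x \<partial>M)"
    using h by (simp add: right_diff_distrib)
  finally show "(\<integral>x. truncated_power l L (U x) \<partial>M) - (\<integral>x. truncated_power l L (U' x) \<partial>M) + h * E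
       \<le> h * (\<integral>x. f x * ?\<phi> x \<partial>M)"
    using 1 by linarith
qed

text \<open>Jensen's inequality for a concave power, through the tangent line at the integral of
  \<open>f\<close>. The crude constant, the total measure plus one, replaces a power of the
  measure.\<close>

lemma integral_powr_le:
  fixes f :: "'b \<Rightarrow> real"
  assumes fm: "finite_measure M" and f: "integrable M f" "\<And>x. 0 \<le> f x" and a: "0 < a" "a \<le> 1"
  shows "integrable M (\<lambda>x. f x powr a)"
    and "(\<integral>x. f x powr a \<partial>M) \<le> (measure M (space M) + 1) * (\<integral>x. f x \<partial>M) powr a"
proof -
  interpret finite_measure M by fact
  have [measurable]: "f \<in> borel_measurable M" using f by simp
  have le: "f x powr a \<le> 1 + f x" for x
  proof -
    have "f x powr a \<le> 1 powr a * (1 - a + a * (f x / 1))"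
      using a f by (intro powr_concave_tangent) auto
    also have "\<dots> \<le> 1 + 1 * f x"
      using a mult_right_mono[OF a(2) f(2)[of x]] by simp
    finally show ?thesis by simp
  qed
  show i: "integrable M (\<lambda>x. f x powr a)"
  proof (rule Bochner_Integration.integrable_bound)
    show "AE x in M. norm (f x powr a) \<le> norm (1 + f x)"
    proof (rule AE_I2)
      fix x show "norm (f x powr a) \<le> norm (1 + f x)" using le[of x] f(2)[of x] by simp
    qed
  qed (use f in auto)
  show "(\<integral>x. f x powr a \<partial>M) \<le> (measure M (space M) + 1) * (\<integral>x. f x \<partial>M) powr a"
  \<comment> \<open>The tangent line needs a positive base point, so a vanishing integral is treated
    apart.\<close>
  proof (cases "(\<integral>x. f x \<partial>M) = 0")
    case True
    then have "AE x in M. f x = 0"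
      using f integral_nonneg_eq_0_iff_AE[of M f] by auto
    then have "AE x in M. f x powr a = 0" by eventually_elim simp
    then have "(\<integral>x. f x powr a \<partial>M) = 0" by (simp add: integral_eq_zero_AE)
    then show ?thesis using True by simp
  next
    case False
    define y where "y = (\<integral>x. f x \<partial>M)"
    have y: "0 < y" using False f Bochner_Integration.integral_nonneg[of M f] by (simp add: y_def less_le)
    have "(\<integral>x. f x powr a \<partial>M) \<le> (\<integral>x. y powr a * (1 + f x / y) \<partial>M)"
    proof (rule integral_mono)
      fix x
      have "f x powr a \<le> y powr a * (1 - a + a * (f x / y))"
        using a f y by (intro powr_concave_tangent) auto
      also have "\<dots> \<le> y powr a * (1 + 1 * (f x / y))"
        using a f(2)[of x] y by (intro mult_left_mono add_mono mult_right_mono) auto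
      finally show "f x powr a \<le> y powr a * (1 + f x / y)" by simp
    qed (use i f in auto)
    also have "\<dots> = y powr a * (measure M (space M) + 1)"
      using f y by (simp add: y_def[symmetric])
    finally show ?thesis by (simp add: y_def mult.commute)
  qed
qed

section \<open>Passing from an Euler iterate to the solution at a nearby time\<close>

lemma abs_clip_powr_lipschitz:
  assumes "1 \<le> g" "0 \<le> L"
  shows "\<bar>\<bar>clip L a\<bar> powr g - \<bar>clip L b\<bar> powr g\<bar> \<le> g * L powr (g - 1) * \<bar>a - b\<bar>"
proof -
  have "\<bar>\<bar>clip L a\<bar> powr g - \<bar>clip L b\<bar> powr g\<bar> \<le> g * L powr (g - 1) * \<bar>clip L a - clip L b\<bar>"
    using assms by (intro abs_powr_lipschitz abs_clip_le)
  also have "\<dots> \<le> g * L powr (g - 1) * \<bar>a - b\<bar>"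
    using assms clip_lipschitz by (intro mult_left_mono) auto
  finally show ?thesis .
qed

text \<open>For \<open>u = beta m v\<close> the source \<open>[v]^(q/m)\<close> is
  \<open>[u]^q\<close>. Replacing \<open>f\<close> by it costs \<open>e\<close> times the bound of
  the test function; replacing \<open>U\<close> by \<open>u\<close> in the test function costs a
  multiple of \<epsilon>, by a Lipschitz bound that uses \<open>l - 1 >= 1\<close>. What remains is
  \<open>|clip L u| powr (l - 1 + q)\<close>, and Jensen with the exponent
  \<open>(l - 1 + q) / l <= 1\<close> brings it to a power of the integral of
  \<open>|clip L u| powr l\<close>.\<close>

lemma source_estimate:
  fixes U u f :: "'b \<Rightarrow> real"
  assumes fm: "finite_measure M" and U: "integrable M U" and u: "integrable M u" and f: "integrable M f"
    and ub: "AE x in M. \<bar>u x\<bar> \<le> L" and L: "0 < L" and l: "2 \<le> l" and q: "0 < q" "q \<le> 1"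
    and Uu: "(\<integral>x. \<bar>U x - u x\<bar> \<partial>M) \<le> \<epsilon>"
    and ef: "(\<integral>\<^sup>+x. ennreal \<bar>spow q (u x) - f x\<bar> \<partial>M) \<le> ennreal e" and e: "0 \<le> e"
  shows "(\<integral>x. f x * spow (l - 1) (clip L (U x)) \<partial>M)
    \<le> (measure M (space M) + 1) * (\<integral>x. \<bar>clip L (u x)\<bar> powr l \<partial>M) powr ((l - 1 + q) / l)
      + L powr q * ((l - 1) * L powr (l - 2)) * \<epsilon> + L powr (l - 1) * e"
proof -
  let ?\<phi> = "\<lambda>x. spow (l - 1) (clip L (U x))"
  define K where "K = (l - 1) * L powr (l - 2)"
  define b where "b = (l - 1 + q) / l"
  have K: "0 \<le> K" using l by (simp add: K_def)
  have b: "0 < b" "b \<le> 1" using l q by (auto simp: b_def)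
  have [measurable]: "U \<in> borel_measurable M" "u \<in> borel_measurable M" "f \<in> borel_measurable M"
    using U u f by auto
  have \<phi>b: "\<bar>?\<phi> x\<bar> \<le> L powr (l - 1)" for x
    using abs_spow_clip_le[of L "l - 1"] L l by auto
  have il: "integrable M (\<lambda>x. \<bar>clip L (u x)\<bar> powr l)"
    using L l abs_clip_le[of L] by (intro integrable_bounded_comp[OF fm, of _ "L powr l"]) (auto intro!: powr_mono2)
  have iq: "integrable M (\<lambda>x. (\<bar>clip L (u x)\<bar> powr l) powr b)"
    and le_q: "(\<integral>x. (\<bar>clip L (u x)\<bar> powr l) powr b \<partial>M)
       \<le> (measure M (space M) + 1) * (\<integral>x. \<bar>clip L (u x)\<bar> powr l \<partial>M) powr b"
    using integral_powr_le[OF fm il _ b] by auto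
  have ig: "integrable M (\<lambda>x. spow q (clip L (u x)))"
    using L q abs_spow_clip_le[of L q] by (intro integrable_bounded_comp[OF fm, of _ "L powr q"]) auto
  \<comment> \<open>Clipping \<open>u\<close> changes nothing almost everywhere, but makes its
    powers bounded and hence integrable.\<close>
  have ae_eq: "AE x in M. spow q (clip L (u x)) = spow q (u x)"
    using ub by eventually_elim (simp add: clip_eq)
  have id: "integrable M (\<lambda>x. \<bar>spow q (clip L (u x)) - f x\<bar>)" using ig f by simp
  have "ennreal (\<integral>x. \<bar>spow q (clip L (u x)) - f x\<bar> \<partial>M) = (\<integral>\<^sup>+x. ennreal \<bar>spow q (clip L (u x)) - f x\<bar> \<partial>M)"
    using id by (intro nn_integral_eq_integral[symmetric]) auto
  also have "\<dots> = (\<integral>\<^sup>+x. ennreal \<bar>spow q (u x) - f x\<bar> \<partial>M)"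
    using ae_eq by (intro nn_integral_cong_AE) auto
  also note ef
  finally have d: "(\<integral>x. \<bar>spow q (clip L (u x)) - f x\<bar> \<partial>M) \<le> e"
    using e by simp
  have pw: "f x * ?\<phi> x \<le> (\<bar>clip L (u x)\<bar> powr l) powr b + L powr q * K * \<bar>U x - u x\<bar>
      + L powr (l - 1) * \<bar>spow q (clip L (u x)) - f x\<bar>" for x
  proof -
    let ?g = "spow q (clip L (u x))"
    have "f x * ?\<phi> x = ?g * ?\<phi> x + (f x - ?g) * ?\<phi> x" by (simp add: algebra_simps)
    moreover have "(f x - ?g) * ?\<phi> x \<le> L powr (l - 1) * \<bar>?g - f x\<bar>"
    proof -
      have "(f x - ?g) * ?\<phi> x \<le> \<bar>f x - ?g\<bar> * \<bar>?\<phi> x\<bar>" by (metis abs_ge_self abs_mult)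
      also have "\<dots> \<le> \<bar>f x - ?g\<bar> * L powr (l - 1)" using \<phi>b by (intro mult_left_mono) auto
      finally show ?thesis by (simp add: abs_minus_commute mult.commute)
    qed
    moreover have "?g * ?\<phi> x \<le> (\<bar>clip L (u x)\<bar> powr l) powr b + L powr q * K * \<bar>U x - u x\<bar>"
    proof -
      have "?g * ?\<phi> x \<le> \<bar>?g\<bar> * \<bar>?\<phi> x\<bar>" by (metis abs_ge_self abs_mult)
      also have "\<dots> = \<bar>clip L (u x)\<bar> powr q * \<bar>clip L (U x)\<bar> powr (l - 1)" by simp
      also have "\<dots> \<le> \<bar>clip L (u x)\<bar> powr q * (\<bar>clip L (u x)\<bar> powr (l - 1) + K * \<bar>U x - u x\<bar>)"
        using abs_clip_powr_lipschitz[of "l - 1" L "U x" "u x"] l L by (intro mult_left_mono) (auto simp: K_def)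
      also have "\<dots> = \<bar>clip L (u x)\<bar> powr (l - 1 + q) + \<bar>clip L (u x)\<bar> powr q * (K * \<bar>U x - u x\<bar>)"
        unfolding powr_add by (simp add: distrib_left mult.commute)
      also have "\<bar>clip L (u x)\<bar> powr q * (K * \<bar>U x - u x\<bar>) \<le> L powr q * (K * \<bar>U x - u x\<bar>)"
        using abs_clip_le[of L "u x"] K L q by (intro mult_right_mono powr_mono2) auto
      also have "\<bar>clip L (u x)\<bar> powr (l - 1 + q) = (\<bar>clip L (u x)\<bar> powr l) powr b"
        using l by (simp add: powr_powr b_def)
      finally show ?thesis by simp
    qed
    ultimately show ?thesis by linarith
  qed
  have iU: "integrable M (\<lambda>x. \<bar>U x - u x\<bar>)" using U u by simp
  have "(\<integral>x. f x * ?\<phi> x \<partial>M) \<le> (\<integral>x. (\<bar>clip L (u x)\<bar> powr l) powr b + L powr q * K * \<bar>U x - u x\<bar>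
      + L powr (l - 1) * \<bar>spow q (clip L (u x)) - f x\<bar> \<partial>M)"
    using pw iU id iq f \<phi>b by (intro integral_mono integrable_mult_bounded[OF f]) auto
  also have "\<dots> = (\<integral>x. (\<bar>clip L (u x)\<bar> powr l) powr b \<partial>M) + L powr q * K * (\<integral>x. \<bar>U x - u x\<bar> \<partial>M)
     + L powr (l - 1) * (\<integral>x. \<bar>spow q (clip L (u x)) - f x\<bar> \<partial>M)"
    using iU id iq by simp
  also have "\<dots> \<le> (measure M (space M) + 1) * (\<integral>x. \<bar>clip L (u x)\<bar> powr l \<partial>M) powr b
     + L powr q * K * \<epsilon> + L powr (l - 1) * e"
    using le_q Uu d K by (intro add_mono mult_left_mono) auto
  finally show ?thesis by (simp add: K_def b_def)
qed

text \<open>The integral is Lipschitz in \<open>L^1\<close>, but its power with \<open>a < 1\<close>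
  is not Lipschitz at \<open>0\<close>; subadditivity of the power leaves an error that is itself an
  \<open>a\<close>-th power of a multiple of \<epsilon>.\<close>

lemma clip_energy_lower:
  fixes U u :: "'b \<Rightarrow> real"
  assumes fm: "finite_measure M" and U: "integrable M U" and u: "integrable M u"
    and L: "0 < L" and l: "1 \<le> l" and a: "0 < a" "a \<le> 1"
    and Uu: "(\<integral>x. \<bar>U x - u x\<bar> \<partial>M) \<le> \<epsilon>"
  shows "(\<integral>x. \<bar>clip L (u x)\<bar> powr l \<partial>M) powr a
     \<le> (\<integral>x. \<bar>clip L (U x)\<bar> powr l \<partial>M) powr a + (l * L powr (l - 1) * \<epsilon>) powr a"
proof -
  let ?X = "\<integral>x. \<bar>clip L (U x)\<bar> powr l \<partial>M" and ?x = "\<integral>x. \<bar>clip L (u x)\<bar> powr l \<partial>M"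
  have "\<bar>?x - ?X\<bar> \<le> l * L powr (l - 1) * (\<integral>x. \<bar>u x - U x\<bar> \<partial>M)"
    using abs_clip_powr_lipschitz[of l L] l L
    by (intro integral_lipschitz_comp[OF fm u U, where G = "\<lambda>a. \<bar>clip L a\<bar> powr l"]) auto
  also have "\<dots> \<le> l * L powr (l - 1) * \<epsilon>"
    using Uu l by (intro mult_left_mono) (auto simp: abs_minus_commute)
  finally have "\<bar>?x - ?X\<bar> powr a \<le> (l * L powr (l - 1) * \<epsilon>) powr a"
    using a by (intro powr_mono2) auto
  moreover have "?x powr a \<le> ?X powr a + \<bar>?x - ?X\<bar> powr a"
    using a by (intro powr_diff_le) auto
  ultimately show ?thesis by linarith
qed

text \<open>Averaging: were the slice integral too large at almost every time, Tonelli would give a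
  total of at least \<open>e + \<epsilon> * (b - a)\<close>. The added \<epsilon> makes this
  contradict the non-strict bound \<open>e\<close>. A property \<open>P\<close> valid almost
  everywhere can be demanded at the time found.\<close>

lemma ex_good_time:
  fixes \<Omega> :: "'a::euclidean_space set" and H :: "real \<times> 'a \<Rightarrow> ennreal"
  assumes ab: "a < b" and \<Omega>: "open \<Omega>"
    and H: "H \<in> borel_measurable (lebesgue_on ({a<..<b} \<times> \<Omega>))"
    and good: "AE t in lebesgue. t \<in> {a<..<b} \<longrightarrow> P t"
    and e: "0 \<le> e" "(\<integral>\<^sup>+z. H z \<partial>lebesgue_on ({a<..<b} \<times> \<Omega>)) \<le> ennreal e" and \<epsilon>: "0 < \<epsilon>"
  shows "\<exists>t\<in>{a<..<b}. P t \<and> (\<integral>\<^sup>+x. H (t, x) \<partial>lebesgue_on \<Omega>) \<le> ennreal (e / (b - a) + \<epsilon>)"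
proof (rule ccontr)
  let ?S = "{a<..<b} \<times> \<Omega>"
  assume "\<not> ?thesis"
  then have big: "ennreal (e / (b - a) + \<epsilon>) \<le> (\<integral>\<^sup>+x. H (t, x) \<partial>lebesgue_on \<Omega>)" if "t \<in> {a<..<b}" "P t" for t
    using that by force
  have S: "?S \<in> sets lebesgue" using \<Omega> by (intro sets_completionI_sets) (auto intro!: open_Times borel_open)
  have \<Omega>s: "\<Omega> \<in> sets lebesgue" using \<Omega> by auto
  have Hm: "(\<lambda>z. H z * indicator ?S z) \<in> borel_measurable lebesgue"
    using H S by (simp add: borel_measurable_restrict_space_iff_ennreal)
  have inner: "(\<integral>\<^sup>+x. H (t, x) * indicator ?S (t, x) \<partial>lebesgue) = (\<integral>\<^sup>+x. H (t, x) \<partial>lebesgue_on \<Omega>) * indicator {a<..<b} t" for t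
    using \<Omega>s by (auto simp: nn_integral_restrict_space indicator_def intro!: nn_integral_cong)
  have "ennreal (e + \<epsilon> * (b - a)) = ennreal (e / (b - a) + \<epsilon>) * ennreal (b - a)"
    using ab e \<epsilon> by (simp add: distrib_right flip: ennreal_mult)
  also have "\<dots> = (\<integral>\<^sup>+t. ennreal (e / (b - a) + \<epsilon>) * indicator {a<..<b} t \<partial>lebesgue)"
    using ab by (subst nn_integral_cmult_indicator) auto
  also have "\<dots> \<le> (\<integral>\<^sup>+t. (\<integral>\<^sup>+x. H (t, x) * indicator ?S (t, x) \<partial>lebesgue) \<partial>lebesgue)"
    unfolding inner
  proof (rule nn_integral_mono_AE)
    show "AE t in lebesgue. ennreal (e / (b - a) + \<epsilon>) * indicator {a<..<b} t
      \<le> (\<integral>\<^sup>+x. H (t, x) \<partial>lebesgue_on \<Omega>) * indicator {a<..<b} t"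
      using good by eventually_elim (auto simp: indicator_def big)
  qed
  also have "\<dots> = (\<integral>\<^sup>+z. H z * indicator ?S z \<partial>lebesgue)"
    by (rule nn_integral_lebesgue_prod(2)[OF Hm, symmetric])
  also have "\<dots> = (\<integral>\<^sup>+z. H z \<partial>lebesgue_on ?S)"
    using S by (simp add: nn_integral_restrict_space)
  also note e(2)
  finally have "e + \<epsilon> * (b - a) \<le> e" using e by simp
  then show False using \<epsilon> ab by (simp add: mult_le_0_iff)
qed

section \<open>Decay and extinction\<close>

text \<open>An integrated, derivative-free form of \<open>y' <= - Z y\<close> with
  \<open>Z y >= k * y powr a\<close>. Halving the level \<open>b n\<close> takes at most a time
  proportional to \<open>b n powr (1 - a)\<close>; because \<open>a < 1\<close>, these times form a
  convergent geometric series, whose sum bounds the extinction time.\<close>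

lemma extinction_of_decay:
  fixes y Z :: "real \<Rightarrow> real"
  assumes cont: "continuous_on {0..T} y" and y0: "y 0 < D" and nonneg: "\<And>t. 0 \<le> y t"
    and k: "0 < k" and a: "0 < a" "a < 1"
    and Z: "\<And>x. 0 \<le> x \<Longrightarrow> x \<le> D \<Longrightarrow> k * x powr a \<le> Z x"
    and decay: "\<And>t1 t2 \<kappa>. 0 \<le> t1 \<Longrightarrow> t1 < t2 \<Longrightarrow> t2 \<le> T \<Longrightarrow> 0 \<le> \<kappa> \<Longrightarrow>
      (\<And>t. t \<in> {t1<..<t2} \<Longrightarrow> \<kappa> \<le> Z (y t)) \<Longrightarrow> y t2 - y t1 \<le> - \<kappa> * (t2 - t1)"
    and T: "2 / k * D powr (1 - a) / (1 - (1 / 2) powr (1 - a)) \<le> T"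
  shows "y T = 0"
proof -
  have D: "0 < D" using y0 nonneg[of 0] by simp
  define \<rho> :: real where "\<rho> = (1 / 2) powr (1 - a)"
  have \<rho>: "0 < \<rho>" "\<rho> < 1"
    using a powr01_less_one[of "1 / 2" "1 - a"] by (auto simp: \<rho>_def)
  define E where "E = 2 / k * D powr (1 - a)"
  have E: "0 < E" using k D by (simp add: E_def)
  have T0: "E / (1 - \<rho>) \<le> T" using T by (simp add: E_def \<rho>_def)
  then have Tpos: "0 < T" using E \<rho> by (smt (verit) divide_pos_pos)
  have Z0: "0 \<le> Z x" if "0 \<le> x" "x \<le> D" for x
    using Z[OF that] k by (smt (verit) mult_nonneg_nonneg powr_ge_zero)
  \<comment> \<open>Decay with rate \<open>0\<close>: before the first time \<open>t2\<close> at
    which level \<open>D\<close> is reached, \<open>Z\<close> is nonnegative along \<open>y\<close>,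
    so \<open>y t2 <= y 0 < D\<close>.\<close>
  have below: "y t < D" if "t \<in> {0..T}" for t
  proof (rule ccontr)
    assume "\<not> y t < D"
    define S where "S = {t \<in> {0..T}. D \<le> y t}"
    have "closed S" unfolding S_def
      using continuous_closed_preimage[OF cont closed_atLeastAtMost, of "{D..}"]
      by (auto simp: vimage_def Int_def conj_commute)
    moreover have "bounded S" by (rule bounded_subset[of "{0..T}"]) (auto simp: S_def)
    ultimately have "compact S" by (simp add: compact_eq_bounded_closed)
    moreover have "S \<noteq> {}" using that \<open>\<not> y t < D\<close> by (auto simp: S_def)
    ultimately obtain t2 where t2: "t2 \<in> S" "\<And>t. t \<in> S \<Longrightarrow> t2 \<le> t"
      using compact_attains_inf by metis
    have t2p: "0 < t2" using t2(1) y0 by (cases "t2 = 0") (auto simp: S_def)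
    have "y t2 - y 0 \<le> - 0 * (t2 - 0)"
    proof (rule decay)
      fix t assume t: "t \<in> {0<..<t2}"
      then have "t \<notin> S" using t2(2)[of t] by auto
      then have "y t \<le> D" using t t2(1) by (auto simp: S_def)
      then show "0 \<le> Z (y t)" using Z0 nonneg by simp
    qed (use t2(1) t2p in \<open>auto simp: S_def\<close>)
    then show False using t2(1) y0 by (simp add: S_def)
  qed
  have anti: "y t2 \<le> y t1" if "0 \<le> t1" "t1 \<le> t2" "t2 \<le> T" for t1 t2
  proof (cases "t1 = t2")
    case False
    have "y t2 - y t1 \<le> - 0 * (t2 - t1)"
    proof (rule decay)
      fix t assume "t \<in> {t1<..<t2}"
      then show "0 \<le> Z (y t)" using Z0 nonneg below[of t] that by simp
    qed (use that False in auto)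
    then show ?thesis by simp
  qed simp
  define b where "b n = D / 2 ^ n" for n :: nat
  \<comment> \<open>\<open>E * \<rho> ^ Suc i\<close> is the time allowed for the descent from
    \<open>b i\<close> to \<open>b (Suc i)\<close>; all of them together stay below
    \<open>E / (1 - \<rho>)\<close>, which is at most \<open>T\<close>.\<close>
  define \<tau> where "\<tau> n = E * (\<Sum>i<n. \<rho> ^ Suc i)" for n
  have b: "0 < b n" for n using D by (simp add: b_def)
  have bpow: "b n powr (1 - a) = D powr (1 - a) * \<rho> ^ n" for n
  proof -
    have "((1 / 2 :: real) ^ n) powr (1 - a) = \<rho> ^ n"
      by (induction n) (simp_all only: power_0 power_Suc powr_mult \<rho>_def powr_one_eq_one)
    moreover have "b n = D * (1 / 2) ^ n" by (simp add: b_def power_one_over field_simps)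
    ultimately show ?thesis by (simp add: powr_mult)
  qed
  have \<tau>T: "\<tau> n \<le> T" for n
  proof -
    have "(\<Sum>i<n. \<rho> ^ Suc i) \<le> (\<Sum>i<n. \<rho> ^ i)"
      using \<rho> by (intro sum_mono) (simp add: mult_left_le_one_le)
    also have "\<dots> = (1 - \<rho> ^ n) / (1 - \<rho>)"
      using \<rho> by (simp add: sum_gp_strict)
    also have "\<dots> \<le> 1 / (1 - \<rho>)"
      using \<rho> by (intro divide_right_mono) auto
    finally have "\<tau> n \<le> E * (1 / (1 - \<rho>))"
      unfolding \<tau>_def using E by (intro mult_left_mono) auto
    then show ?thesis using T0 by simp
  qed
  have \<tau>0: "0 \<le> \<tau> n" for n
    unfolding \<tau>_def using E \<rho> by (intro mult_nonneg_nonneg sum_nonneg) auto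
  have step: "y (\<tau> n) \<le> b n" for n
  proof (induction n)
    case 0
    show ?case using y0 by (simp add: \<tau>_def b_def)
  next
    case (Suc n)
    show ?case
    proof (rule ccontr)
      assume "\<not> ?case"
      then have gt: "b (Suc n) < y (\<tau> (Suc n))" by simp
      define \<kappa> where "\<kappa> = k * b (Suc n) powr a"
      have \<Delta>: "\<tau> (Suc n) - \<tau> n = E * \<rho> ^ Suc n" by (simp add: \<tau>_def algebra_simps)
      have less: "\<tau> n < \<tau> (Suc n)" using \<Delta> E \<rho> by (smt (verit) mult_pos_pos zero_less_power)
      \<comment> \<open>By monotonicity \<open>y\<close> exceeds \<open>b (Suc n)\<close> on the
        whole interval, so the rate \<kappa> applies. Over this interval it removes
        \<open>b n\<close>, all that was left, and \<open>y\<close> could not end above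
        \<open>b (Suc n)\<close>.\<close>
      have "y (\<tau> (Suc n)) - y (\<tau> n) \<le> - \<kappa> * (\<tau> (Suc n) - \<tau> n)"
      proof (rule decay)
        fix t assume t: "t \<in> {\<tau> n<..<\<tau> (Suc n)}"
        have tT: "0 \<le> t" "t \<le> T" using t \<tau>0[of n] \<tau>T[of "Suc n"] by auto
        have "b (Suc n) \<le> y t"
          using anti[of t "\<tau> (Suc n)"] t tT \<tau>T[of "Suc n"] gt by auto
        then have "\<kappa> \<le> k * y t powr a"
          unfolding \<kappa>_def using k a b[of "Suc n"] by (intro mult_left_mono powr_mono2) auto
        also have "\<dots> \<le> Z (y t)" using Z nonneg below[of t] tT by simp
        finally show "\<kappa> \<le> Z (y t)" .
      qed (use k \<tau>0 \<tau>T less in \<open>auto simp: \<kappa>_def\<close>)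
      also have "\<kappa> * (\<tau> (Suc n) - \<tau> n) = b n"
      proof -
        have "\<kappa> * (\<tau> (Suc n) - \<tau> n) = 2 * (b (Suc n) powr a * (D powr (1 - a) * \<rho> ^ Suc n))"
          unfolding \<Delta> \<kappa>_def E_def using k by simp
        also have "\<dots> = 2 * (b (Suc n) powr a * b (Suc n) powr (1 - a))" by (simp only: bpow)
        also have "\<dots> = 2 * b (Suc n)" using b[of "Suc n"] by (simp flip: powr_add)
        finally show ?thesis by (simp add: b_def)
      qed
      then have "- \<kappa> * (\<tau> (Suc n) - \<tau> n) = - b n" by simp
      finally have "y (\<tau> (Suc n)) \<le> 0" using Suc.IH by simp
      then show False using gt b[of "Suc n"] by simp
    qed
  qed
  have "y T \<le> b n" for n
    using anti[of "\<tau> n" T] \<tau>0 \<tau>T step[of n] by (meson order_trans order_refl)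
  moreover have "b \<longlonglongrightarrow> 0"
    unfolding b_def using LIMSEQ_divide_realpow_zero[of 2 D] by simp
  ultimately have "y T \<le> 0"
    by (intro LIMSEQ_le_const[of b 0]) auto
  then show ?thesis using nonneg[of T] by simp
qed

section \<open>The Lyapunov functional along a mild solution\<close>

lemma L1dist_eq_integral:
  assumes "integrable (lebesgue_on \<Omega>) f" "integrable (lebesgue_on \<Omega>) g"
  shows "L1dist \<Omega> f g = ennreal (\<integral>x. \<bar>f x - g x\<bar> \<partial>lebesgue_on \<Omega>)"
  unfolding L1dist_def using assms by (intro nn_integral_eq_integral) auto

text \<open>For \<open>u = beta m v\<close> with \<open>|u| <= L\<close> almost everywhere and
  \<open>l = r * m + 1\<close> this is the integral of \<open>|v| powr (r + 1/m)\<close> divided by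
  \<open>l\<close>. Euler iterates, which may exceed \<open>L\<close>, can be measured by it as
  well.\<close>

definition Lyap :: "'a::euclidean_space set \<Rightarrow> real \<Rightarrow> real \<Rightarrow> ('a \<Rightarrow> real) \<Rightarrow> real" where
  "Lyap \<Omega> l L u = (\<integral>x. truncated_power l L (u x) \<partial>lebesgue_on \<Omega>)"

lemma Lyap_lipschitz:
  assumes fm: "finite_measure (lebesgue_on \<Omega>)" and "1 < l" "0 < L"
    and "integrable (lebesgue_on \<Omega>) u" "integrable (lebesgue_on \<Omega>) w"
  shows "\<bar>Lyap \<Omega> l L u - Lyap \<Omega> l L w\<bar> \<le> L powr (l - 1) * (\<integral>x. \<bar>u x - w x\<bar> \<partial>lebesgue_on \<Omega>)"
  unfolding Lyap_def using truncated_power_lipschitz[OF assms(2,3)]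
  by (intro integral_lipschitz_comp[OF fm assms(4,5)]) auto

lemma Lyap_eq:
  assumes "1 < l" "AE x in lebesgue_on \<Omega>. \<bar>u x\<bar> \<le> L" and um: "u \<in> borel_measurable (lebesgue_on \<Omega>)"
  shows "l * Lyap \<Omega> l L u = (\<integral>x. \<bar>clip L (u x)\<bar> powr l \<partial>lebesgue_on \<Omega>)"
proof -
  note um[measurable]
  have "Lyap \<Omega> l L u = (\<integral>x. \<bar>clip L (u x)\<bar> powr l / l \<partial>lebesgue_on \<Omega>)"
    unfolding Lyap_def
  proof (rule integral_cong_AE)
    show "AE x in lebesgue_on \<Omega>. truncated_power l L (u x) = \<bar>clip L (u x)\<bar> powr l / l"
      using assms(2) by eventually_elim (simp add: truncated_power_eq clip_eq)
  qed measurable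
  then show ?thesis using assms(1) by simp
qed

text \<open>Inside one mesh slab there is a time \<open>t\<close> with the bound by
  \<open>L\<close>, a source error of at most the slab average plus \<epsilon>, and the rate
  \<kappa>; the energy and the source term of \<open>U\<close> are both compared with the solution
  at \<open>t\<close>. Multiplication by the step \<open>b - a\<close> turns the average
  \<open>e / (b - a)\<close> back into \<open>e\<close>, which can be summed over slabs.\<close>

lemma slab_decrease:
  fixes \<Omega> :: "'a::euclidean_space set" and v :: "real \<Rightarrow> 'a \<Rightarrow> real"
  assumes \<Omega>: "open \<Omega>" "bounded \<Omega>" and ab: "a < b" and L: "0 < L" and l: "2 \<le> l"
    and q: "0 < q" "q \<le> 1" and \<alpha>: "0 < \<alpha>" "\<alpha> \<le> 1" and c: "0 < c" and \<epsilon>: "0 < \<epsilon>" and e: "0 \<le> e"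
    and U: "integrable (lebesgue_on \<Omega>) U" and U': "integrable (lebesgue_on \<Omega>) U'"
    and F: "integrable (lebesgue_on \<Omega>) (\<lambda>x. f x - (U x - U' x) / (b - a))"
    and en: "c * (\<integral>x. \<bar>clip L (U x)\<bar> powr l \<partial>lebesgue_on \<Omega>) powr \<alpha>
      \<le> (\<integral>x. (f x - (U x - U' x) / (b - a)) * spow (l - 1) (clip L (U x)) \<partial>lebesgue_on \<Omega>)"
    and u: "\<And>t. t \<in> {a<..<b} \<Longrightarrow> integrable (lebesgue_on \<Omega>) (\<lambda>x. spow (1 / m) (v t x))"
    and Uu: "\<And>t. t \<in> {a<..<b} \<Longrightarrow> L1dist \<Omega> U (\<lambda>x. spow (1 / m) (v t x)) \<le> ennreal \<epsilon>"
    and vm: "unc v \<in> borel_measurable (lebesgue_on ({a<..<b} \<times> \<Omega>))"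
    and good: "AE t in lebesgue. t \<in> {a<..<b} \<longrightarrow> (AE x in lebesgue_on \<Omega>. \<bar>spow (1 / m) (v t x)\<bar> \<le> L)"
    and ef: "(\<integral>\<^sup>+z. ennreal \<bar>spow (q / m) (v (fst z) (snd z)) - f (snd z)\<bar> \<partial>lebesgue_on ({a<..<b} \<times> \<Omega>)) \<le> ennreal e"
    and \<kappa>: "\<And>t. t \<in> {a<..<b} \<Longrightarrow> \<kappa> \<le> c * (l * Lyap \<Omega> l L (\<lambda>x. spow (1 / m) (v t x))) powr \<alpha>
       - (measure lebesgue \<Omega> + 1) * (l * Lyap \<Omega> l L (\<lambda>x. spow (1 / m) (v t x))) powr ((l - 1 + q) / l)"
  shows "Lyap \<Omega> l L U - Lyap \<Omega> l L U' \<le> - \<kappa> * (b - a)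
     + (b - a) * (c * (l * L powr (l - 1) * \<epsilon>) powr \<alpha> + L powr q * ((l - 1) * L powr (l - 2)) * \<epsilon> + L powr (l - 1) * \<epsilon>)
     + L powr (l - 1) * e"
proof -
  let ?\<mu> = "lebesgue_on \<Omega>"
  have \<Omega>s: "\<Omega> \<in> sets lebesgue" using \<Omega> by auto
  have fm: "finite_measure ?\<mu>"
    using \<Omega> \<Omega>s by (intro finite_measure_lebesgue_on bounded_set_imp_lmeasurable)
  have ms: "measure ?\<mu> (space ?\<mu>) = measure lebesgue \<Omega>"
    using \<Omega>s by (simp add: measure_restrict_space)
  have l1: "1 < l" using l by simp
  have h: "0 < b - a" using ab by simp
  note es = implicit_euler_step[OF fm U U' F h L l1 en]
  have f: "integrable ?\<mu> f" by (rule es(1))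
  have fz: "(\<lambda>z. f (snd z)) \<in> borel_measurable (lebesgue_on ({a<..<b} \<times> \<Omega>))"
  proof -
    have "(\<lambda>x. f x * indicator \<Omega> x) \<in> borel_measurable lebesgue"
      using f \<Omega>s borel_measurable_restrict_space_iff[of \<Omega> lebesgue f] by (simp add: mult.commute)
    from measurable_compose[OF measurable_lebesgue_snd this]
    have "(\<lambda>z::real \<times> 'a. f (snd z) * indicator \<Omega> (snd z)) \<in> borel_measurable (lebesgue_on ({a<..<b} \<times> \<Omega>))"
      by (rule measurable_restrict_space1)
    then show ?thesis
      by (subst measurable_lebesgue_cong[where g = "\<lambda>z. f (snd z) * indicator \<Omega> (snd z)"]) auto
  qed
  have Hm: "(\<lambda>z. ennreal \<bar>spow (q / m) (v (fst z) (snd z)) - f (snd z)\<bar>) \<in> borel_measurable (lebesgue_on ({a<..<b} \<times> \<Omega>))"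
  proof -
    have [measurable]: "(\<lambda>z. v (fst z) (snd z)) \<in> borel_measurable (lebesgue_on ({a<..<b} \<times> \<Omega>))"
      using vm by (simp add: unc_def[abs_def])
    note fz[measurable]
    show ?thesis by measurable
  qed
  obtain t where t: "t \<in> {a<..<b}" and tL: "AE x in ?\<mu>. \<bar>spow (1 / m) (v t x)\<bar> \<le> L"
    and tf: "(\<integral>\<^sup>+x. ennreal \<bar>spow (q / m) (v t x) - f x\<bar> \<partial>?\<mu>) \<le> ennreal (e / (b - a) + \<epsilon>)"
    using ex_good_time[OF ab \<Omega>(1) Hm good e ef \<epsilon>] by auto
  define w where "w x = spow (1 / m) (v t x)" for x
  have wi: "integrable ?\<mu> w" using u[OF t] by (simp add: w_def[abs_def])
  have wL: "AE x in ?\<mu>. \<bar>w x\<bar> \<le> L" using tL by (simp add: w_def)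
  have Uw: "(\<integral>x. \<bar>U x - w x\<bar> \<partial>?\<mu>) \<le> \<epsilon>"
    using Uu[OF t] \<epsilon> unfolding w_def[symmetric] L1dist_eq_integral[OF U wi] by simp
  have wf: "(\<integral>\<^sup>+x. ennreal \<bar>spow q (w x) - f x\<bar> \<partial>?\<mu>) \<le> ennreal (e / (b - a) + \<epsilon>)"
    using tf by (simp add: w_def spow_spow)
  let ?x = "\<integral>x. \<bar>clip L (w x)\<bar> powr l \<partial>?\<mu>" and ?X = "\<integral>x. \<bar>clip L (U x)\<bar> powr l \<partial>?\<mu>"
  let ?s = "\<integral>x. f x * spow (l - 1) (clip L (U x)) \<partial>?\<mu>"
  let ?B = "measure lebesgue \<Omega> + 1" and ?K = "L powr q * ((l - 1) * L powr (l - 2))"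
  let ?\<beta> = "(l - 1 + q) / l" and ?\<Lambda> = "L powr (l - 1)"
  have eq: "l * Lyap \<Omega> l L w = ?x"
    using wi by (intro Lyap_eq[OF l1 wL]) simp
  have k: "\<kappa> \<le> c * ?x powr \<alpha> - ?B * ?x powr ?\<beta>"
    using \<kappa>[OF t] unfolding w_def[symmetric] eq .
  have "?s \<le> ?B * ?x powr ?\<beta> + ?K * \<epsilon> + ?\<Lambda> * (e / (b - a) + \<epsilon>)"
    using source_estimate[OF fm U wi f wL L l q Uw wf] e h \<epsilon> unfolding ms by simp
  moreover have "c * ?x powr \<alpha> \<le> c * (?X powr \<alpha> + (l * ?\<Lambda> * \<epsilon>) powr \<alpha>)"
    using clip_energy_lower[OF fm U wi L _ \<alpha> Uw, of l] l c by (intro mult_left_mono) auto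
  ultimately have "?s - c * ?X powr \<alpha> \<le> - \<kappa> + (c * (l * ?\<Lambda> * \<epsilon>) powr \<alpha> + ?K * \<epsilon> + ?\<Lambda> * \<epsilon>) + ?\<Lambda> * (e / (b - a))"
    using k by (simp add: distrib_left)
  then have "(b - a) * (?s - c * ?X powr \<alpha>) \<le> (b - a) * (- \<kappa> + (c * (l * ?\<Lambda> * \<epsilon>) powr \<alpha> + ?K * \<epsilon> + ?\<Lambda> * \<epsilon>) + ?\<Lambda> * (e / (b - a)))"
    using h by (intro mult_left_mono) auto
  also have "\<dots> = - \<kappa> * (b - a) + (b - a) * (c * (l * ?\<Lambda> * \<epsilon>) powr \<alpha> + ?K * \<epsilon> + ?\<Lambda> * \<epsilon>)
     + (b - a) * (?\<Lambda> * (e / (b - a)))"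
    by (simp add: algebra_simps)
  also have "(b - a) * (?\<Lambda> * (e / (b - a))) = ?\<Lambda> * e" using h by simp
  finally show ?thesis
    using es(2) unfolding Lyap_def by (simp add: right_diff_distrib)
qed

lemma Lyap_continuous:
  fixes \<Omega> :: "'a::euclidean_space set"
  assumes fm: "finite_measure (lebesgue_on \<Omega>)" and l: "1 < l" and L: "0 < L" and u: "cont_Lr \<Omega> 1 T u"
  shows "continuous_on {0..T} (\<lambda>t. Lyap \<Omega> l L (u t))"
  unfolding continuous_on_def
proof
  fix t assume t: "t \<in> {0..T}"
  let ?F = "at t within {0..T}"
  have ui: "integrable (lebesgue_on \<Omega>) (u \<tau>)" if "\<tau> \<in> {0..T}" for \<tau>
    using u that unfolding cont_Lr_def Lp_on_1_iff_integrable by auto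
  define D where "D \<tau> = (\<integral>x. \<bar>u \<tau> x - u t x\<bar> \<partial>lebesgue_on \<Omega>)" for \<tau>
  have ev: "\<forall>\<^sub>F \<tau> in ?F. \<tau> \<in> {0..T}" by (simp add: eventually_at_filter)
  have "((\<lambda>\<tau>. \<integral>\<^sup>+x. ennreal (\<bar>u \<tau> x - u t x\<bar> powr 1) \<partial>lebesgue_on \<Omega>) \<longlongrightarrow> 0) ?F"
    using u t unfolding cont_Lr_def by auto
  moreover have "\<forall>\<^sub>F \<tau> in ?F. (\<integral>\<^sup>+x. ennreal (\<bar>u \<tau> x - u t x\<bar> powr 1) \<partial>lebesgue_on \<Omega>) = ennreal (D \<tau>)"
    using ev
  proof eventually_elim
    case (elim \<tau>)
    then show ?case using L1dist_eq_integral[OF ui[OF elim] ui[OF t]] by (simp add: L1dist_def D_def)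
  qed
  ultimately have "((\<lambda>\<tau>. ennreal (D \<tau>)) \<longlongrightarrow> ennreal 0) ?F"
    using tendsto_cong by fastforce
  then have D: "(D \<longlongrightarrow> 0) ?F"
    by (subst (asm) tendsto_ennreal_iff) (auto simp: D_def)
  have "((\<lambda>\<tau>. Lyap \<Omega> l L (u \<tau>) - Lyap \<Omega> l L (u t)) \<longlongrightarrow> 0) ?F"
  proof (rule Lim_null_comparison)
    show "\<forall>\<^sub>F \<tau> in ?F. norm (Lyap \<Omega> l L (u \<tau>) - Lyap \<Omega> l L (u t)) \<le> L powr (l - 1) * D \<tau>"
      using ev by eventually_elim (use Lyap_lipschitz[OF fm l L ui ui[OF t]] in \<open>simp add: D_def\<close>)
    show "((\<lambda>\<tau>. L powr (l - 1) * D \<tau>) \<longlongrightarrow> 0) ?F"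
      using tendsto_mult_left[OF D, of "L powr (l - 1)"] by simp
  qed
  then show "((\<lambda>\<tau>. Lyap \<Omega> l L (u \<tau>)) \<longlongrightarrow> Lyap \<Omega> l L (u t)) ?F"
    by (simp add: LIM_zero_iff)
qed

lemma step_sum_le:
  fixes x w e :: "nat \<Rightarrow> real"
  assumes "k \<le> n" and "\<And>i. i \<in> {Suc k..n} \<Longrightarrow> x i - x (i - 1) \<le> A * (w i - w (i - 1)) + B * e i"
  shows "x n - x k \<le> A * (w n - w k) + B * (\<Sum>i=Suc k..n. e i)"
  using assms
proof (induction n rule: dec_induct)
  case (step n)
  have "x n - x k \<le> A * (w n - w k) + B * (\<Sum>i=Suc k..n. e i)"
    by (rule step.IH) (use step.prems in auto)
  moreover have "x (Suc n) - x n \<le> A * (w (Suc n) - w n) + B * e (Suc n)"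
    using step.prems[of "Suc n"] step.hyps by simp
  moreover have "{Suc k..Suc n} = insert (Suc n) {Suc k..n}" using step.hyps by auto
  ultimately show ?case by (simp add: algebra_simps)
qed simp

text \<open>The total error at mesh width \<epsilon>: \<open>T\<close> times the error per unit time
  of \<open>slab_decrease\<close>, and three terms \<open>L powr (l - 1) * \<epsilon>\<close>, two
  for replacing iterates by the solution at both ends and one for the summed source errors.\<close>

definition mesh_error :: "real \<Rightarrow> real \<Rightarrow> real \<Rightarrow> real \<Rightarrow> real \<Rightarrow> real \<Rightarrow> real \<Rightarrow> real" where
  "mesh_error c L l q \<alpha> T \<epsilon> = T * (c * (l * L powr (l - 1) * \<epsilon>) powr \<alpha>
     + L powr q * ((l - 1) * L powr (l - 2)) * \<epsilon> + L powr (l - 1) * \<epsilon>) + 3 * (L powr (l - 1) * \<epsilon>)"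

lemma mesh_error_tendsto_0:
  assumes "0 < \<alpha>" "e \<longlonglongrightarrow> 0" "\<And>n. 0 < e n" "0 < L" "1 < l"
  shows "(\<lambda>n. mesh_error c L l q \<alpha> T (e n)) \<longlonglongrightarrow> 0"
proof -
  have "(\<lambda>n. l * L powr (l - 1) * e n) \<longlonglongrightarrow> l * L powr (l - 1) * 0"
    using assms by (intro tendsto_intros)
  then have "(\<lambda>n. (l * L powr (l - 1) * e n) powr \<alpha>) \<longlonglongrightarrow> 0"
    using assms by (intro tendsto_zero_powrI[where b = \<alpha>] always_eventually allI mult_nonneg_nonneg)
      (auto simp: less_imp_le)
  then have "(\<lambda>n. T * (c * (l * L powr (l - 1) * e n) powr \<alpha>
     + L powr q * ((l - 1) * L powr (l - 2)) * e n + L powr (l - 1) * e n) + 3 * (L powr (l - 1) * e n))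
     \<longlonglongrightarrow> T * (c * 0 + L powr q * ((l - 1) * L powr (l - 2)) * 0 + L powr (l - 1) * 0) + 3 * (L powr (l - 1) * 0)"
    using assms by (intro tendsto_intros)
  then show ?thesis by (simp add: mesh_error_def)
qed

text \<open>Slab estimates are summed over the slabs that lie entirely between \<open>t1\<close> and
  \<open>t2\<close>, since the rate \<kappa> is assumed only there; hence the conclusion speaks of
  mesh points \<open>a\<close> and \<open>b\<close> near the two ends.\<close>

lemma mild_decay_approx:
  fixes \<Omega> :: "'a::euclidean_space set" and v :: "real \<Rightarrow> 'a \<Rightarrow> real" and l L m :: real
  defines "W \<equiv> \<lambda>t. Lyap \<Omega> l L (\<lambda>x. spow (1 / m) (v t x))"
  assumes \<Omega>: "open \<Omega>" "bounded \<Omega>" and L: "0 < L" and l: "2 \<le> l"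
    and q: "0 < q" "q \<le> 1" and \<alpha>: "0 < \<alpha>" "\<alpha> \<le> 1" and c: "0 < c"
    and en: "\<And>U F. A_rel \<Omega> s p m U F \<Longrightarrow> c * (\<integral>x. \<bar>clip L (U x)\<bar> powr l \<partial>lebesgue_on \<Omega>) powr \<alpha>
      \<le> (\<integral>x. F x * spow (l - 1) (clip L (U x)) \<partial>lebesgue_on \<Omega>)"
    and mild: "mild_sol \<Omega> s p m T (\<lambda>t x. spow (q / m) (v t x)) u0 (\<lambda>t x. beta m (v t x))"
    and vm: "unc v \<in> borel_measurable (lebesgue_on (QT T \<Omega>))"
    and good: "AE t in lebesgue. t \<in> {0<..<T} \<longrightarrow> (AE x in lebesgue_on \<Omega>. \<bar>spow (1 / m) (v t x)\<bar> \<le> L)"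
    and t12: "0 \<le> t1" "t1 < t2" "t2 \<le> T"
    and \<kappa>: "\<And>t. t \<in> {t1<..<t2} \<Longrightarrow> \<kappa> \<le> c * (l * W t) powr \<alpha>
       - (measure lebesgue \<Omega> + 1) * (l * W t) powr ((l - 1 + q) / l)"
    and \<epsilon>: "0 < \<epsilon>" "\<epsilon> < t2 - t1"
  shows "\<exists>a b. t1 \<le> a \<and> a \<le> b \<and> b \<le> t2 \<and> a \<le> t1 + \<epsilon> \<and> t2 - \<epsilon> \<le> b \<and>
     W b - W a \<le> - \<kappa> * (b - a) + mesh_error c L l q \<alpha> T \<epsilon>"
proof -
  let ?\<mu> = "lebesgue_on \<Omega>"
  define u where "u t x = spow (1 / m) (v t x)" for t x
  have W: "W t = Lyap \<Omega> l L (u t)" for t by (simp add: W_def u_def[abs_def])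
  have beta: "(\<lambda>t x. beta m (v t x)) = u" by (intro ext) (simp add: beta_def u_def)
  have \<Omega>s: "\<Omega> \<in> sets lebesgue" using \<Omega> by auto
  have fm: "finite_measure ?\<mu>"
    using \<Omega> \<Omega>s by (intro finite_measure_lebesgue_on bounded_set_imp_lmeasurable)
  have l1: "1 < l" using l by simp
  define \<Lambda> where "\<Lambda> = L powr (l - 1)"
  have \<Lambda>: "0 < \<Lambda>" using L by (simp add: \<Lambda>_def)
  have mild': "mild_sol \<Omega> s p m T (\<lambda>t x. spow (q / m) (v t x)) u0 u"
    using mild unfolding beta .
  have ui: "integrable ?\<mu> (u t)" if "t \<in> {0..T}" for t
    using mild' that unfolding mild_sol_def cont_Lr_def Lp_on_1_iff_integrable by auto
  obtain N :: nat and tt U f where disc: "tt 0 = 0 \<and> tt N = T \<and>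
        (\<forall>i\<in>{1..N}. tt (i - 1) < tt i \<and> tt i - tt (i - 1) < \<epsilon>) \<and>
        Lp_on \<Omega> 1 (U 0) \<and> L1dist \<Omega> (U 0) u0 \<le> ennreal \<epsilon> \<and>
        (\<forall>i\<in>{1..N}. A_rel \<Omega> s p m (U i)
            (\<lambda>x. f i x - (U i x - U (i - 1) x) / (tt i - tt (i - 1)))) \<and>
        (\<Sum>i=1..N. \<integral>\<^sup>+z. ennreal \<bar>spow (q / m) (v (fst z) (snd z)) - f i (snd z)\<bar>
             \<partial>lebesgue_on ({tt (i - 1)<..<tt i} \<times> \<Omega>)) < ennreal \<epsilon> \<and>
        L1dist \<Omega> (U 0) (u 0) < ennreal \<epsilon> \<and>
        (\<forall>i\<in>{1..N}. \<forall>\<tau>\<in>{tt (i - 1)<..tt i}. L1dist \<Omega> (U i) (u \<tau>) < ennreal \<epsilon>)"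
    using mild'[unfolded mild_sol_def, THEN conjunct2, THEN spec, THEN mp, OF \<epsilon>(1)] by (elim exE) (rule that)
  have tt0: "tt 0 = 0" and ttN: "tt N = T"
    and tts: "\<And>i. i \<in> {1..N} \<Longrightarrow> tt (i - 1) < tt i \<and> tt i - tt (i - 1) < \<epsilon>"
    and U0: "Lp_on \<Omega> 1 (U 0)"
    and A: "\<And>i. i \<in> {1..N} \<Longrightarrow> A_rel \<Omega> s p m (U i) (\<lambda>x. f i x - (U i x - U (i - 1) x) / (tt i - tt (i - 1)))"
    and fs: "(\<Sum>i=1..N. \<integral>\<^sup>+z. ennreal \<bar>spow (q / m) (v (fst z) (snd z)) - f i (snd z)\<bar>
             \<partial>lebesgue_on ({tt (i - 1)<..<tt i} \<times> \<Omega>)) < ennreal \<epsilon>"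
    and d0: "L1dist \<Omega> (U 0) (u 0) < ennreal \<epsilon>"
    and di: "\<And>i \<tau>. i \<in> {1..N} \<Longrightarrow> \<tau> \<in> {tt (i - 1)<..tt i} \<Longrightarrow> L1dist \<Omega> (U i) (u \<tau>) < ennreal \<epsilon>"
    using disc by simp_all
  have mono: "tt i \<le> tt j" if "i \<le> j" "j \<le> N" for i j
    using that
  proof (induction j rule: dec_induct)
    case (step j)
    then show ?case using tts[of "Suc j"] by simp
  qed simp
  have ttr: "tt i \<in> {0..T}" if "i \<le> N" for i
    using mono[of 0 i] mono[of i N] that tt0 ttN by simp
  have Ui: "integrable ?\<mu> (U i)" if "i \<le> N" for i
    using U0 A[of i] that unfolding A_rel_def Lp_on_1_iff_integrable by (cases "i = 0") auto
  \<comment> \<open>\<open>U i\<close> is compared with the solution on the half-open slab ending at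
    \<open>tt i\<close>, so time \<open>0\<close> draws on its own closeness condition.\<close>
  have WU: "\<bar>Lyap \<Omega> l L (U i) - W (tt i)\<bar> \<le> \<Lambda> * \<epsilon>" if i: "i \<le> N" for i
  proof -
    have "L1dist \<Omega> (U i) (u (tt i)) \<le> ennreal \<epsilon>"
    proof (cases "i = 0")
      case True then show ?thesis using d0 tt0 by simp
    next
      case False then show ?thesis using di[of i "tt i"] tts[of i] i by auto
    qed
    then have "(\<integral>x. \<bar>U i x - u (tt i) x\<bar> \<partial>?\<mu>) \<le> \<epsilon>"
      using \<epsilon> by (simp add: L1dist_eq_integral[OF Ui[OF i] ui[OF ttr[OF i]]])
    then have "\<Lambda> * (\<integral>x. \<bar>U i x - u (tt i) x\<bar> \<partial>?\<mu>) \<le> \<Lambda> * \<epsilon>"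
      using \<Lambda> by (intro mult_left_mono) auto
    then show ?thesis
      using Lyap_lipschitz[OF fm l1 L Ui[OF i] ui[OF ttr[OF i]]] by (simp add: W \<Lambda>_def)
  qed
  define J where "J i = (\<integral>\<^sup>+z. ennreal \<bar>spow (q / m) (v (fst z) (snd z)) - f i (snd z)\<bar>
             \<partial>lebesgue_on ({tt (i - 1)<..<tt i} \<times> \<Omega>))" for i
  define e where "e i = enn2real (J i)" for i
  have Jfin: "J i = ennreal (e i)" if "i \<in> {1..N}" for i
  proof -
    have "J i \<le> (\<Sum>i=1..N. J i)" using that by (intro member_le_sum) auto
    then have "J i < \<infinity>" using fs unfolding J_def[symmetric] by (auto intro: order.strict_trans1 order.strict_trans)
    then show ?thesis by (simp add: e_def)
  qed
  have e0: "0 \<le> e i" for i by (simp add: e_def)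
  have es: "(\<Sum>i=1..N. e i) \<le> \<epsilon>"
  proof -
    have "ennreal (\<Sum>i=1..N. e i) = (\<Sum>i=1..N. ennreal (e i))"
      using e0 by (intro sum_ennreal[symmetric])
    also have "\<dots> = (\<Sum>i=1..N. J i)"
      by (intro sum.cong refl Jfin[symmetric])
    also have "\<dots> \<le> ennreal \<epsilon>" using fs by (simp add: J_def)
    finally show ?thesis using \<epsilon> by simp
  qed
  \<comment> \<open>The first mesh point at or after \<open>t1\<close>; its predecessor, if any,
    lies before \<open>t1\<close>, and one step is shorter than \<epsilon>.\<close>
  define k where "k = (LEAST i. t1 \<le> tt i)"
  have kt: "t1 \<le> tt k" and kN: "k \<le> N"
    using LeastI[of "\<lambda>i. t1 \<le> tt i" N] Least_le[of "\<lambda>i. t1 \<le> tt i" N] ttN t12 by (auto simp: k_def)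
  have ku: "tt k \<le> t1 + \<epsilon>"
  proof (cases "k = 0")
    case False
    then have "\<not> t1 \<le> tt (k - 1)"
      unfolding k_def using not_less_Least[of "k - 1" "\<lambda>i. t1 \<le> tt i"] by (simp add: k_def)
    then show ?thesis using tts[of k] False kN by auto
  qed (use tt0 t12 \<epsilon> in simp)
  \<comment> \<open>Mesh points up to \<open>t2\<close>. That \<open>k\<close> belongs to them uses
    \<open>\<epsilon> < t2 - t1\<close>; the largest one is within one step of
    \<open>t2\<close>.\<close>
  define S where "S = {i. i \<le> N \<and> tt i \<le> t2}"
  have S: "finite S" "k \<in> S" using kN ku \<epsilon> by (auto simp: S_def)
  define n where "n = Max S"
  have "n \<in> S" unfolding n_def using S by (intro Max_in) auto
  have "k \<le> n" unfolding n_def using S by (intro Max_ge)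
  have nN: "n \<le> N" and nt: "tt n \<le> t2" using \<open>n \<in> S\<close> by (auto simp: S_def)
  have nl: "t2 - \<epsilon> \<le> tt n"
  proof (cases "n = N")
    case False
    then have "Suc n \<notin> S" using Max_ge[OF S(1), of "Suc n"] by (auto simp: n_def)
    then have "t2 < tt (Suc n)" using False nN by (auto simp: S_def)
    then show ?thesis using tts[of "Suc n"] False nN by auto
  qed (use ttN t12 \<epsilon> in simp)
  \<comment> \<open>The part of the error proportional to the slab length. The source errors
    \<open>e i\<close> are kept apart, because it is their sum that is at most \<epsilon>.\<close>
  define \<eta> where "\<eta> = c * (l * \<Lambda> * \<epsilon>) powr \<alpha> + L powr q * ((l - 1) * L powr (l - 2)) * \<epsilon> + \<Lambda> * \<epsilon>"
  have \<eta>: "0 \<le> \<eta>" using c l \<epsilon> \<Lambda> unfolding \<eta>_def by (intro add_nonneg_nonneg mult_nonneg_nonneg) auto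
  have "Lyap \<Omega> l L (U n) - Lyap \<Omega> l L (U k) \<le> (- \<kappa> + \<eta>) * (tt n - tt k) + \<Lambda> * (\<Sum>i=Suc k..n. e i)"
  proof (rule step_sum_le[OF \<open>k \<le> n\<close>])
    fix i assume i: "i \<in> {Suc k..n}"
    then have iN: "i \<in> {1..N}" "i \<le> N" "i - 1 \<le> N" using nN by auto
    let ?a = "tt (i - 1)" and ?b = "tt i"
    have sub: "{?a<..<?b} \<subseteq> {t1<..<t2}"
    proof -
      have "tt k \<le> ?a" "?b \<le> tt n" using mono[of k "i - 1"] mono[of i n] i iN nN by auto
      then show ?thesis using kt nt by auto
    qed
    have subT: "{?a<..<?b} \<subseteq> {0<..<T}" using sub t12 by auto
    have "Lyap \<Omega> l L (U i) - Lyap \<Omega> l L (U (i - 1)) \<le> - \<kappa> * (?b - ?a)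
     + (?b - ?a) * (c * (l * L powr (l - 1) * \<epsilon>) powr \<alpha> + L powr q * ((l - 1) * L powr (l - 2)) * \<epsilon> + L powr (l - 1) * \<epsilon>)
     + L powr (l - 1) * e i"
    proof (rule slab_decrease[OF \<Omega> _ L l q \<alpha> c \<epsilon>(1) e0 Ui Ui])
      show "?a < ?b" using tts[OF iN(1)] by simp
      show "integrable ?\<mu> (\<lambda>x. f i x - (U i x - U (i - 1) x) / (?b - ?a))"
        using A[OF iN(1)] unfolding A_rel_def Lp_on_1_iff_integrable by simp
      show "c * (\<integral>x. \<bar>clip L (U i x)\<bar> powr l \<partial>?\<mu>) powr \<alpha>
        \<le> (\<integral>x. (f i x - (U i x - U (i - 1) x) / (?b - ?a)) * spow (l - 1) (clip L (U i x)) \<partial>?\<mu>)"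
        by (rule en[OF A[OF iN(1)]])
      show "integrable ?\<mu> (\<lambda>x. spow (1 / m) (v t x))" if "t \<in> {?a<..<?b}" for t
        using ui[of t] subT that by (auto simp: u_def[abs_def])
      show "L1dist \<Omega> (U i) (\<lambda>x. spow (1 / m) (v t x)) \<le> ennreal \<epsilon>" if "t \<in> {?a<..<?b}" for t
        using di[OF iN(1), of t] that by (simp add: u_def[abs_def])
      show "unc v \<in> borel_measurable (lebesgue_on ({?a<..<?b} \<times> \<Omega>))"
        using vm by (rule measurable_restrict_mono) (use subT in \<open>auto simp: QT_def\<close>)
      show "AE t in lebesgue. t \<in> {?a<..<?b} \<longrightarrow> (AE x in ?\<mu>. \<bar>spow (1 / m) (v t x)\<bar> \<le> L)"
        using good by eventually_elim (use subT in auto)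
      show "(\<integral>\<^sup>+z. ennreal \<bar>spow (q / m) (v (fst z) (snd z)) - f i (snd z)\<bar> \<partial>lebesgue_on ({?a<..<?b} \<times> \<Omega>)) \<le> ennreal (e i)"
        using Jfin[OF iN(1)] by (simp add: J_def)
      show "\<kappa> \<le> c * (l * Lyap \<Omega> l L (\<lambda>x. spow (1 / m) (v t x))) powr \<alpha>
       - (measure lebesgue \<Omega> + 1) * (l * Lyap \<Omega> l L (\<lambda>x. spow (1 / m) (v t x))) powr ((l - 1 + q) / l)"
        if "t \<in> {?a<..<?b}" for t
        using \<kappa>[of t] sub that unfolding W_def by auto
    qed (use iN in auto)
    also have "\<dots> = (- \<kappa> + \<eta>) * (?b - ?a) + \<Lambda> * e i"
      by (simp add: \<eta>_def \<Lambda>_def algebra_simps)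
    finally show "Lyap \<Omega> l L (U i) - Lyap \<Omega> l L (U (i - 1)) \<le> (- \<kappa> + \<eta>) * (?b - ?a) + \<Lambda> * e i" .
  qed
  also have "\<dots> \<le> - \<kappa> * (tt n - tt k) + \<eta> * T + \<Lambda> * \<epsilon>"
  proof -
    have "(\<Sum>i=Suc k..n. e i) \<le> (\<Sum>i=1..N. e i)"
      using e0 nN by (intro sum_mono2) auto
    then have "\<Lambda> * (\<Sum>i=Suc k..n. e i) \<le> \<Lambda> * \<epsilon>"
      using es \<Lambda> by (intro mult_left_mono) auto
    moreover have "\<eta> * (tt n - tt k) \<le> \<eta> * T"
      using \<eta> ttr[OF nN] ttr[OF kN] by (intro mult_left_mono) auto
    ultimately show ?thesis by (simp add: algebra_simps)
  qed
  finally have "W (tt n) - W (tt k) \<le> - \<kappa> * (tt n - tt k) + (\<eta> * T + 3 * (\<Lambda> * \<epsilon>))"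
    using WU[OF nN] WU[OF kN] by (simp add: abs_le_iff)
  moreover have "\<eta> * T + 3 * (\<Lambda> * \<epsilon>) = mesh_error c L l q \<alpha> T \<epsilon>"
    by (simp add: mesh_error_def \<eta>_def \<Lambda>_def mult.commute)
  ultimately show ?thesis
    using kt ku nt nl mono[OF \<open>k \<le> n\<close> nN] by (intro exI[of _ "tt k"] exI[of _ "tt n"]) auto
qed

text \<open>The limit of vanishing mesh: \<open>a\<close> and \<open>b\<close> converge to
  \<open>t1\<close> and \<open>t2\<close>, and continuity of the functional in time, a consequence
  of its \<open>L^1\<close> Lipschitz bound, carries the estimate over.\<close>

lemma mild_decay:
  fixes \<Omega> :: "'a::euclidean_space set" and v :: "real \<Rightarrow> 'a \<Rightarrow> real" and l L m :: real
  defines "W \<equiv> \<lambda>t. Lyap \<Omega> l L (\<lambda>x. spow (1 / m) (v t x))"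
  assumes \<Omega>: "open \<Omega>" "bounded \<Omega>" and L: "0 < L" and l: "2 \<le> l"
    and q: "0 < q" "q \<le> 1" and \<alpha>: "0 < \<alpha>" "\<alpha> \<le> 1" and c: "0 < c"
    and en: "\<And>U F. A_rel \<Omega> s p m U F \<Longrightarrow> c * (\<integral>x. \<bar>clip L (U x)\<bar> powr l \<partial>lebesgue_on \<Omega>) powr \<alpha>
      \<le> (\<integral>x. F x * spow (l - 1) (clip L (U x)) \<partial>lebesgue_on \<Omega>)"
    and mild: "mild_sol \<Omega> s p m T (\<lambda>t x. spow (q / m) (v t x)) u0 (\<lambda>t x. beta m (v t x))"
    and vm: "unc v \<in> borel_measurable (lebesgue_on (QT T \<Omega>))"
    and good: "AE t in lebesgue. t \<in> {0<..<T} \<longrightarrow> (AE x in lebesgue_on \<Omega>. \<bar>spow (1 / m) (v t x)\<bar> \<le> L)"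
    and t12: "0 \<le> t1" "t1 < t2" "t2 \<le> T"
    and \<kappa>: "\<And>t. t \<in> {t1<..<t2} \<Longrightarrow> \<kappa> \<le> c * (l * W t) powr \<alpha>
       - (measure lebesgue \<Omega> + 1) * (l * W t) powr ((l - 1 + q) / l)"
  shows "W t2 - W t1 \<le> - \<kappa> * (t2 - t1)"
proof -
  \<comment> \<open>The offset \<open>2\<close> keeps every mesh width strictly below
    \<open>t2 - t1\<close>, also for \<open>j = 0\<close>.\<close>
  define e where "e j = (t2 - t1) / real (j + 2)" for j :: nat
  have e: "0 < e j" "e j < t2 - t1" for j
    using t12 by (auto simp: e_def divide_less_eq)
  have e0: "e \<longlonglongrightarrow> 0"
    unfolding e_def using LIMSEQ_ignore_initial_segment[OF lim_const_over_n[of "t2 - t1"], of 2] by simp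
  have "\<forall>j. \<exists>a b. t1 \<le> a \<and> a \<le> b \<and> b \<le> t2 \<and> a \<le> t1 + e j \<and> t2 - e j \<le> b \<and>
     W b - W a \<le> - \<kappa> * (b - a) + mesh_error c L l q \<alpha> T (e j)"
    unfolding W_def using mild_decay_approx[OF \<Omega> L l q \<alpha> c en mild vm good t12 _ e] \<kappa>[unfolded W_def] by blast
  then obtain a b where ab: "\<And>j. t1 \<le> a j" "\<And>j. a j \<le> b j" "\<And>j. b j \<le> t2" "\<And>j. a j \<le> t1 + e j" "\<And>j. t2 - e j \<le> b j"
     "\<And>j. W (b j) - W (a j) \<le> - \<kappa> * (b j - a j) + mesh_error c L l q \<alpha> T (e j)"
    by metis
  have a: "a \<longlonglongrightarrow> t1"
  proof (rule tendsto_sandwich[where f = "\<lambda>_. t1" and h = "\<lambda>j. t1 + e j"])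
    show "(\<lambda>j. t1 + e j) \<longlonglongrightarrow> t1" using tendsto_add[OF tendsto_const e0, of t1] by simp
  qed (use ab in auto)
  have b: "b \<longlonglongrightarrow> t2"
  proof (rule tendsto_sandwich[where f = "\<lambda>j. t2 - e j" and h = "\<lambda>_. t2"])
    show "(\<lambda>j. t2 - e j) \<longlonglongrightarrow> t2" using tendsto_diff[OF tendsto_const e0, of t2] by simp
  qed (use ab in auto)
  have fm: "finite_measure (lebesgue_on \<Omega>)"
    using \<Omega> by (intro finite_measure_lebesgue_on bounded_set_imp_lmeasurable) auto
  have beta: "(\<lambda>t x. beta m (v t x)) = (\<lambda>t x. spow (1 / m) (v t x))" by (intro ext) (simp add: beta_def)
  have cont: "continuous_on {0..T} W"
    unfolding W_def using mild l L unfolding mild_sol_def beta by (intro Lyap_continuous[OF fm]) auto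
  have W: "(\<lambda>j. W (a j)) \<longlonglongrightarrow> W t1" "(\<lambda>j. W (b j)) \<longlonglongrightarrow> W t2"
  proof -
    have "a j \<in> {0..T}" "b j \<in> {0..T}" for j
      using ab(1,2,3)[of j] t12 by auto
    then show "(\<lambda>j. W (a j)) \<longlonglongrightarrow> W t1" "(\<lambda>j. W (b j)) \<longlonglongrightarrow> W t2"
      using t12 by (auto intro!: continuous_on_tendsto_compose[OF cont] a b)
  qed
  have "(\<lambda>j. - \<kappa> * (b j - a j) + mesh_error c L l q \<alpha> T (e j)) \<longlonglongrightarrow> - \<kappa> * (t2 - t1) + 0"
    using a b mesh_error_tendsto_0[OF \<alpha>(1) e0 e(1) L] l by (intro tendsto_intros) auto
  moreover have "(\<lambda>j. W (b j) - W (a j)) \<longlonglongrightarrow> W t2 - W t1"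
    using W by (intro tendsto_intros)
  ultimately have "W t2 - W t1 \<le> - \<kappa> * (t2 - t1) + 0"
    using ab(6) by (intro LIMSEQ_le[of "\<lambda>j. W (b j) - W (a j)"]) auto
  then show ?thesis by simp
qed

text \<open>Fubini for null sets: an exceptional set that is null in space-time has null slices at
  almost every time. At a prescribed time such as \<open>0\<close> or \<open>T\<close> this gives no
  bound.\<close>

lemma Linf_QT_slices:
  fixes \<Omega> :: "'a::euclidean_space set" and v :: "real \<Rightarrow> 'a \<Rightarrow> real"
  assumes \<Omega>: "open \<Omega>" and v: "Linf_on (QT T \<Omega>) (unc v)" and m: "0 < m"
  shows "\<exists>L>0. AE t in lebesgue. t \<in> {0<..<T} \<longrightarrow> (AE x in lebesgue_on \<Omega>. \<bar>spow (1 / m) (v t x)\<bar> \<le> L)"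
proof -
  obtain C where C: "AE z in lebesgue_on (QT T \<Omega>). \<bar>unc v z\<bar> \<le> C"
    using v by (auto simp: Linf_on_def)
  have Q: "QT T \<Omega> \<in> sets lebesgue"
    unfolding QT_def using \<Omega> by (intro sets_completionI_sets) (auto intro!: open_Times borel_open)
  have "AE z in lebesgue. (fst z, snd z) \<in> QT T \<Omega> \<longrightarrow> \<bar>v (fst z) (snd z)\<bar> \<le> C"
    using C Q by (simp add: AE_restrict_space_iff unc_def)
  from AE_lebesgue_fst_snd[OF this]
  have ae: "AE t in lebesgue. AE x in lebesgue. (t, x) \<in> QT T \<Omega> \<longrightarrow> \<bar>v t x\<bar> \<le> C" .
  \<comment> \<open>\<open>C\<close> need not be positive, but a truncation level must be.\<close>
  define M where "M = max C 1"
  have M: "0 < M" by (simp add: M_def)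
  show ?thesis
  proof (intro exI[of _ "M powr (1 / m)"] conjI)
    show "AE t in lebesgue. t \<in> {0<..<T} \<longrightarrow> (AE x in lebesgue_on \<Omega>. \<bar>spow (1 / m) (v t x)\<bar> \<le> M powr (1 / m))"
      using ae
    proof eventually_elim
      case (elim t)
      show ?case
      proof
        assume t: "t \<in> {0<..<T}"
        have "AE x in lebesgue. x \<in> \<Omega> \<longrightarrow> \<bar>spow (1 / m) (v t x)\<bar> \<le> M powr (1 / m)"
          using elim
        proof eventually_elim
          case (elim x)
          show ?case
          proof
            assume "x \<in> \<Omega>"
            then have "\<bar>v t x\<bar> \<le> M" using elim t by (auto simp: QT_def M_def)
            then show "\<bar>spow (1 / m) (v t x)\<bar> \<le> M powr (1 / m)"
              using m by (simp add: powr_mono2)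
          qed
        qed
        then show "AE x in lebesgue_on \<Omega>. \<bar>spow (1 / m) (v t x)\<bar> \<le> M powr (1 / m)"
          using \<Omega> by (simp add: AE_restrict_space_iff)
      qed
    qed
  qed (use M in simp)
qed

section \<open>Choice of the exponent and the threshold, and conclusion\<close>

lemma ex_sobolev_exponent:
  fixes p s m d :: real
  assumes "1 < p" "0 < s" "1 < m" "0 < d"
  shows "\<exists>r\<ge>1. (r + 1 / m) / (r + p - 1) \<le> 1 + s * p / d"
proof (intro exI conjI)
  \<comment> \<open>Cleared of denominators the condition reads
    \<open>1/m <= (p - 1) + (s * p / d) * (r + p - 1)\<close>; already
    \<open>r * (s * p / d) >= 1/m\<close> suffices.\<close>
  let ?r = "max 1 (d / (m * s * p))"
  show "1 \<le> ?r" by simp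
  have "1 / m = d / (m * s * p) * (s * p / d)" using assms by simp
  also have "\<dots> \<le> ?r * (s * p / d)" using assms by (intro mult_right_mono) auto
  also have "\<dots> \<le> (?r + p - 1) * (s * p / d)" using assms by (intro mult_right_mono) auto
  finally have "?r + 1 / m \<le> (1 + s * p / d) * (?r + p - 1)"
    using assms by (simp add: algebra_simps)
  moreover have "0 < ?r + p - 1" using assms by simp
  ultimately show "(?r + 1 / m) / (?r + p - 1) \<le> 1 + s * p / d"
    by (simp add: pos_divide_le_eq)
qed

text \<open>\<open>D\<close> is the point where \<open>B * x powr (b - a)\<close> reaches
  \<open>c / 2\<close>; up to it the higher power uses up at most half of the lower one.\<close>

lemma absorb_higher_power:
  fixes a b c B :: real
  assumes "a < b" "0 < c" "0 < B"
  shows "\<exists>D>0. \<forall>x. 0 \<le> x \<longrightarrow> x \<le> D \<longrightarrow> c / 2 * x powr a \<le> c * x powr a - B * x powr b"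
proof (intro exI conjI allI impI)
  let ?D = "(c / (2 * B)) powr (1 / (b - a))"
  show "0 < ?D" using assms by simp
  fix x :: real assume x: "0 \<le> x" "x \<le> ?D"
  have "x powr b = x powr a * x powr (b - a)" by (simp flip: powr_add)
  also have "\<dots> \<le> x powr a * ?D powr (b - a)"
    using x assms by (intro mult_left_mono powr_mono2) auto
  also have "?D powr (b - a) = c / (2 * B)" using assms by (simp add: powr_powr)
  finally have "B * x powr b \<le> B * (x powr a * (c / (2 * B)))"
    using assms by (intro mult_left_mono) auto
  then show "c / 2 * x powr a \<le> c * x powr a - B * x powr b" using assms by (simp add: mult.commute)
qed

theorem theorem1p5:
  fixes \<Omega> :: "'a::euclidean_space set" and p s m q :: real
  assumes "smooth_bounded_domain \<Omega>"
    and "1 < p" and "0 < s" and "s < 1" and "1 < m"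
    and "0 < q" and "q \<le> 1" and "p < q / m + 1"
  shows "\<exists>r\<ge>1. \<exists>\<delta>>0. \<forall>v0 v.
           Linf_on \<Omega> v0 \<and> W0 \<Omega> s p v0 \<and>
           (\<integral>\<^sup>+x. ennreal (\<bar>v0 x\<bar> powr (r + 1 / m)) \<partial>lebesgue_on \<Omega>) < ennreal (\<delta> powr (r + 1 / m)) \<and>
           inf_weak_mild_sol \<Omega> s p m q v0 v
           \<longrightarrow> (\<exists>t0>0. \<forall>t\<ge>t0. AE x in lebesgue_on \<Omega>. v t x = 0)"
proof -
  note p = assms(2) and s = assms(3) and m = assms(5) and q = assms(6,7)
  have \<Omega>: "open \<Omega>" "bounded \<Omega>" using assms(1) by (auto simp: smooth_bounded_domain_def)
  have \<Omega>s: "\<Omega> \<in> sets lebesgue" using \<Omega> by auto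
  let ?\<mu> = "lebesgue_on \<Omega>"
  have fm: "finite_measure ?\<mu>"
    using \<Omega> \<Omega>s by (intro finite_measure_lebesgue_on bounded_set_imp_lmeasurable)
  obtain r where r: "1 \<le> r" and rk: "(r + 1 / m) / (r + p - 1) \<le> 1 + s * p / real DIM('a)"
    using ex_sobolev_exponent[OF p s m, of "real DIM('a)"] by auto
  \<comment> \<open>The exponent for \<open>u = beta m v\<close>:
    \<open>|u| powr l = |v| powr (r + 1/m)\<close>. Then \<alpha> is the exponent of the energy and
    \<beta> that of the source.\<close>
  define l where "l = r * m + 1"
  define \<alpha> where "\<alpha> = (r + p - 1) / (r + 1 / m)"
  define \<beta> where "\<beta> = (l - 1 + q) / l"
  have "1 * 1 \<le> r * m" using r m by (intro mult_mono) auto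
  then have l: "2 \<le> l" by (simp add: l_def)
  have rm: "0 < r + 1 / m" using r m by (auto intro: add_pos_pos)
  have lm: "l / m = r + 1 / m" using m by (simp add: l_def field_simps)
  \<comment> \<open>\<open>q <= 1\<close> gives \<open>p - 1 < q / m <= 1 / m\<close>, the reason
    for \<open>\<alpha> < 1\<close>.\<close>
  have "q / m \<le> 1 / m" using q m by (intro divide_right_mono) auto
  then have \<alpha>: "0 < \<alpha>" "\<alpha> < 1" using r p rm assms(8) by (auto simp: \<alpha>_def)
  have "\<beta> = (r + q / m) / (r + 1 / m)"
  proof -
    have "\<beta> = ((l - 1 + q) / m) / (l / m)" using m by (simp add: \<beta>_def)
    also have "(l - 1 + q) / m = r + q / m" using m by (simp add: l_def add_divide_distrib)
    finally show ?thesis by (simp add: lm)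
  qed
  then have \<alpha>\<beta>: "\<alpha> < \<beta>" using rm assms(8) by (simp add: \<alpha>_def divide_strict_right_mono)
  obtain c where c: "0 < c" and en: "\<And>U F L. A_rel \<Omega> s p m U F \<Longrightarrow> 0 < L \<Longrightarrow>
      c * (\<integral>x. \<bar>clip L (U x)\<bar> powr l \<partial>?\<mu>) powr \<alpha> \<le> (\<integral>x. F x * spow (l - 1) (clip L (U x)) \<partial>?\<mu>)"
    using energy_estimate[OF \<Omega>(2) \<Omega>s s p _ r rk] m unfolding l_def \<alpha>_def by auto
  define B where "B = measure lebesgue \<Omega> + 1"
  have B: "0 < B" by (simp add: B_def add_nonneg_pos)
  define Z where "Z x = c * x powr \<alpha> - B * x powr \<beta>" for x
  obtain D where D: "0 < D" and ZD: "\<And>x. 0 \<le> x \<Longrightarrow> x \<le> D \<Longrightarrow> c / 2 * x powr \<alpha> \<le> Z x"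
    using absorb_higher_power[OF \<alpha>\<beta> c B] unfolding Z_def by blast
  \<comment> \<open>The power \<open>r + 1/m\<close> of \<delta> is the threshold \<open>D\<close>
    up to which half of the energy survives the source.\<close>
  define \<delta> where "\<delta> = D powr (1 / (r + 1 / m))"
  have \<delta>: "0 < \<delta>" "\<delta> powr (r + 1 / m) = D" using D rm by (auto simp: \<delta>_def powr_powr)
  \<comment> \<open>The time from \<open>extinction_of_decay\<close> for the rate constant
    \<open>c / 2\<close>. It is fixed before \<open>v\<close>, so neither the horizon nor
    \<open>L\<close> can affect it.\<close>
  define t0 where "t0 = 2 / (c / 2) * D powr (1 - \<alpha>) / (1 - (1 / 2) powr (1 - \<alpha>))"
  have "(1 / 2 :: real) powr (1 - \<alpha>) < 1" using \<alpha> powr01_less_one[of "1 / 2" "1 - \<alpha>"] by auto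
  then have t0: "0 < t0" using c D by (simp add: t0_def)
  show ?thesis
  proof (rule exI[of _ r], rule conjI[OF r], rule exI[of _ \<delta>], rule conjI[OF \<delta>(1)], intro allI impI)
    fix v0 :: "'a \<Rightarrow> real" and v
    assume H: "Linf_on \<Omega> v0 \<and> W0 \<Omega> s p v0 \<and>
       (\<integral>\<^sup>+x. ennreal (\<bar>v0 x\<bar> powr (r + 1 / m)) \<partial>?\<mu>) < ennreal (\<delta> powr (r + 1 / m)) \<and>
       inf_weak_mild_sol \<Omega> s p m q v0 v"
    \<comment> \<open>Every \<open>T\<close> beyond \<open>t0\<close> is a horizon of its own, with
      its own \<open>L\<close>, and extinction is proved at its end point; this covers all later
      times at once.\<close>
    have "AE x in ?\<mu>. v T x = 0" if T: "t0 \<le> T" for T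
    proof -
      have T0: "0 < T" using T t0 by simp
      have vL: "Linf_on (QT T \<Omega>) (unc v)"
        and v0: "AE x in ?\<mu>. v 0 x = v0 x"
        and mild: "mild_sol \<Omega> s p m T (\<lambda>t x. spow (q / m) (v t x)) (\<lambda>x. beta m (v0 x)) (\<lambda>t x. beta m (v t x))"
        using H T0 unfolding inf_weak_mild_sol_def weak_mild_sol_def weak_sol_def by auto
      obtain L where L: "0 < L"
        and good: "AE t in lebesgue. t \<in> {0<..<T} \<longrightarrow> (AE x in ?\<mu>. \<bar>spow (1 / m) (v t x)\<bar> \<le> L)"
        using Linf_QT_slices[OF \<Omega>(1) vL, of m] m by auto
      define u where "u t x = spow (1 / m) (v t x)" for t x
      have beta: "(\<lambda>t x. beta m (v t x)) = u" by (intro ext) (simp add: beta_def u_def)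
      have cu: "cont_Lr \<Omega> 1 T u" using mild unfolding mild_sol_def beta by blast
      have ui: "integrable ?\<mu> (u t)" if "t \<in> {0..T}" for t
        using cu that unfolding cont_Lr_def Lp_on_1_iff_integrable by auto
      have l1: "1 < l" using l by simp
      have \<Phi>i: "integrable ?\<mu> (\<lambda>x. truncated_power l L (u t x))" if "t \<in> {0..T}" for t
        by (rule integrable_lipschitz_comp[OF fm ui[OF that] _ truncated_power_lipschitz[OF l1 L]]) simp
      define y where "y t = l * Lyap \<Omega> l L (u t)" for t
      have y0: "y 0 < D"
      proof -
        have "ennreal (y 0) = ennreal (\<integral>x. l * truncated_power l L (u 0 x) \<partial>?\<mu>)"
          by (simp add: y_def Lyap_def)
        also have "\<dots> = (\<integral>\<^sup>+x. ennreal (l * truncated_power l L (u 0 x)) \<partial>?\<mu>)"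
          using \<Phi>i[of 0] T0 l1 L truncated_power_nonneg[of l L]
          by (intro nn_integral_eq_integral[symmetric]) auto
        \<comment> \<open>No comparison of \<open>u 0\<close> with \<open>L\<close> is made: the
          truncated power is below the full one in any case.\<close>
        also have "\<dots> \<le> (\<integral>\<^sup>+x. ennreal (\<bar>v0 x\<bar> powr (r + 1 / m)) \<partial>?\<mu>)"
        proof (rule nn_integral_mono_AE)
          show "AE x in ?\<mu>. ennreal (l * truncated_power l L (u 0 x)) \<le> ennreal (\<bar>v0 x\<bar> powr (r + 1 / m))"
            using v0
          proof eventually_elim
            case (elim x)
            have "l * truncated_power l L (u 0 x) \<le> l * (\<bar>u 0 x\<bar> powr l / l)"
              using truncated_power_le[OF l1 L] l1 by (intro mult_left_mono) auto
            also have "\<dots> = \<bar>v0 x\<bar> powr (r + 1 / m)"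
              using l1 elim by (simp add: u_def powr_powr lm)
            finally show ?case by (rule ennreal_leI)
          qed
        qed
        also have "\<dots> < ennreal D" using H \<delta> by simp
        finally show ?thesis by (meson ennreal_leI leD not_le)
      qed
      have "y T = 0"
      proof (rule extinction_of_decay[where y = y and D = D and k = "c / 2" and a = \<alpha> and Z = Z])
        show "continuous_on {0..T} y"
          unfolding y_def by (intro continuous_on_mult_left Lyap_continuous[OF fm l1 L cu])
        show "0 \<le> y t" for t
          unfolding y_def Lyap_def using l1 L truncated_power_nonneg[of l L]
          by (intro mult_nonneg_nonneg Bochner_Integration.integral_nonneg) auto
        show "0 < c / 2" using c by simp
        show "y 0 < D" "0 < \<alpha>" "\<alpha> < 1" by (fact y0 \<alpha>)+
        show "c / 2 * x powr \<alpha> \<le> Z x" if "0 \<le> x" "x \<le> D" for x using ZD that .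
        show "2 / (c / 2) * D powr (1 - \<alpha>) / (1 - (1 / 2) powr (1 - \<alpha>)) \<le> T"
          using T by (simp add: t0_def)
        fix t1 t2 \<kappa> assume t12: "0 \<le> t1" "t1 < t2" "t2 \<le> T" and \<kappa>: "0 \<le> \<kappa>"
          "\<And>t. t \<in> {t1<..<t2} \<Longrightarrow> \<kappa> \<le> Z (y t)"
        have "Lyap \<Omega> l L (u t2) - Lyap \<Omega> l L (u t1) \<le> - \<kappa> * (t2 - t1)"
          unfolding u_def[abs_def]
          using mild_decay[OF \<Omega> L l q \<alpha>(1) less_imp_le[OF \<alpha>(2)] c en[OF _ L] mild _ good t12]
            vL \<kappa>(2) by (simp add: Linf_on_def Z_def y_def u_def[abs_def] B_def \<beta>_def)
        then have "y t2 - y t1 \<le> l * (- \<kappa> * (t2 - t1))"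
          unfolding y_def right_diff_distrib[symmetric] using l1 by (intro mult_left_mono) auto
        \<comment> \<open>\<open>y\<close> is \<open>l\<close> times the functional and decays
          \<open>l\<close> times as fast; this factor is given away.\<close>
        also have "\<dots> \<le> 1 * (- \<kappa> * (t2 - t1))"
          using l1 \<kappa>(1) t12 by (intro mult_right_mono_neg) auto
        finally show "y t2 - y t1 \<le> - \<kappa> * (t2 - t1)" by simp
      qed
      then have "(\<integral>x. truncated_power l L (u T x) \<partial>?\<mu>) = 0"
        using l1 by (simp add: y_def Lyap_def)
      \<comment> \<open>A bound of \<open>u T\<close> by \<open>L\<close> is not at hand for the
        single time \<open>T\<close>; it suffices that the truncated power vanishes only at
        \<open>0\<close>.\<close>
      then have "AE x in ?\<mu>. truncated_power l L (u T x) = 0"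
        using \<Phi>i[of T] T0 truncated_power_nonneg[of l L] l1 L
        by (subst (asm) integral_nonneg_eq_0_iff_AE) auto
      then show ?thesis
      proof eventually_elim
        case (elim x)
        then have "\<bar>u T x\<bar> = 0" using truncated_power_eq_0_iff[OF l1 L] by simp
        then show ?case unfolding u_def abs_spow by simp
      qed
    qed
    then show "\<exists>t0>0. \<forall>t\<ge>t0. AE x in ?\<mu>. v t x = 0" using t0 by blast
  qed
qed

end
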